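(* Let $(p_i)_{i\in\mathbb{I}}$ be a probability distribution on $\mathbb{I}$, not depending on $n$, with $p_i<1$ for all $i\in\mathbb{I}$. For each $n\ge1$ let $G=(G_1,\dots,G_n)$ be i.i.d. with $\mathbb{P}(G_j=i)=p_i$, and let $c_j$ be the number of cycles of length $j$ of $\mathrm{std}(G)$. Fix $k\ge1$ and let $(X_{\mathbf{i}})_{\mathbf{i}\in\widetilde{Q}_l,\,l\le k}$ be independent random variables with $X_{\mathbf{i}}\sim\mathrm{Geo}_0(1-p_{\mathbf{i}})$. Then, as $n\to+\infty$, $$(c_1,\dots,c_k)\ \overset{(d)}{\longrightarrow}\ \left(\sum_{\mathbf{i}\in\widetilde{Q}_1}X_{\mathbf{i}},\ \dots,\ \sum_{\mathbf{i}\in\widetilde{Q}_k}X_{\mathbf{i}}\right),$$ i.e. the limit has independent coordinates, the $l$-th one being distributed as $\sum_{\mathbf{i}\in\widetilde{Q}_l}X_{\mathbf{i}}$.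
   Context: $\mathbb{I}\subset\mathbb{R}$ is a countable set. For $g=(g_1,\dots,g_n)\in\mathbb{R}^n$, the standardized permutation $\sigma=\mathrm{std}(g)\in\mathfrak{S}_n$ is defined by: $\sigma(j)<\sigma(k)$ if and only if $g_j<g_k$, or $g_j=g_k$ and $j<k$. A word $\mathbf{i}\in\mathbb{I}^k$ is a (nontrivial) power if $\mathbf{i}=y^l$ for some word $y$ and integer $l\ge2$; it is primitive if it is not a power. $Q_k$ is the set of primitive words of length $k$ over $\mathbb{I}$. Two words are conjugate if one is a cyclic shift of the other; $\widetilde{Q}_k$ is the set of conjugacy classes of words of $Q_k$. Write $p_{\mathbf{i}}=p_{i_1}\cdots p_{i_k}$ (this depends only on the conjugacy class). $\mathrm{Geo}_0(p)$ is the geometric distribution on $\{0,1,2,\dots\}$: $\mathbb{P}(X=j)=(1-p)^jp$. *)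

theory Defs
  imports "HOL-Probability.Probability" "HOL-Combinatorics.Orbits"
begin

text \<open>A vector of \<open>\<real>\<^sup>n\<close> is a function \<open>g :: nat \<Rightarrow> real\<close> of which only the values on \<open>{1..n}\<close> matter;
  a permutation in \<open>\<SS>\<^sub>n\<close> is a function on \<^typ>\<open>nat\<close> that permutes \<open>{1..n}\<close>, fixing all other numbers.\<close>

definition is_std :: "nat \<Rightarrow> (nat \<Rightarrow> real) \<Rightarrow> (nat \<Rightarrow> nat) \<Rightarrow> bool" where
  "is_std n g \<sigma> \<longleftrightarrow> \<sigma> permutes {1..n} \<and>
     (\<forall>j\<in>{1..n}. \<forall>k\<in>{1..n}. \<sigma> j < \<sigma> k \<longleftrightarrow> g j < g k \<or> (g j = g k \<and> j < k))"

definition std_perm :: "nat \<Rightarrow> (nat \<Rightarrow> real) \<Rightarrow> nat \<Rightarrow> nat" where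
  "std_perm n g = (THE \<sigma>. is_std n g \<sigma>)"

lemma is_std_ex: "\<exists>\<sigma>. is_std n g \<sigma>"
proof -
  define L where "L = (\<lambda>j k. g j < g k \<or> (g j = g k \<and> j < (k::nat)))"
  define R where "R = (\<lambda>j. {i\<in>{1..n}. L i j \<or> i = j})"
  define \<sigma> where "\<sigma> = (\<lambda>j. if j \<in> {1..n} then card (R j) else j)"
  have fin: "finite (R j)" for j by (simp add: R_def)
  have mono: "card (R j) < card (R k)" if "L j k" "j \<in> {1..n}" "k \<in> {1..n}" for j k
  proof (rule psubset_card_mono[OF fin])
    have "k \<in> R k" "k \<notin> R j" using that by (auto simp: R_def L_def)
    moreover have "R j \<subseteq> R k" using that by (auto simp: R_def L_def)
    ultimately show "R j \<subset> R k" by blast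
  qed
  have tot: "L j k \<or> j = k \<or> L k j" for j k by (auto simp: L_def)
  have asym: "\<not> (L j k \<and> L k j)" "\<not> L j j" for j k by (auto simp: L_def)
  have iff: "\<sigma> j < \<sigma> k \<longleftrightarrow> L j k" if "j \<in> {1..n}" "k \<in> {1..n}" for j k
    using mono[of j k] mono[of k j] tot[of j k] asym that by (auto simp: \<sigma>_def)
  have inj: "inj_on \<sigma> {1..n}"
  proof (rule inj_onI)
    fix j k assume jk: "j \<in> {1..n}" "k \<in> {1..n}" "\<sigma> j = \<sigma> k"
    have "\<not> L j k" "\<not> L k j" using iff[OF jk(1,2)] iff[OF jk(2,1)] jk(3) by simp_all
    then show "j = k" using tot[of j k] by blast
  qed
  have "\<sigma> ` {1..n} \<subseteq> {1..n}"
  proof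
    fix y assume "y \<in> \<sigma> ` {1..n}"
    then obtain j where j: "j \<in> {1..n}" "y = card (R j)" by (auto simp: \<sigma>_def)
    have "j \<in> R j" using j by (simp add: R_def)
    then have "card (R j) \<noteq> 0" using fin by auto
    moreover have "card (R j) \<le> card {1..n}" by (rule card_mono) (auto simp: R_def)
    ultimately show "y \<in> {1..n}" using j by simp
  qed
  then have "\<sigma> ` {1..n} = {1..n}" by (rule endo_inj_surj[OF finite_atLeastAtMost _ inj])
  then have "bij_betw \<sigma> {1..n} {1..n}" using inj by (simp add: bij_betw_def)
  then have "\<sigma> permutes {1..n}" by (rule bij_imp_permutes) (auto simp: \<sigma>_def)
  then show ?thesis using iff unfolding is_std_def L_def by blast
qed

lemma is_std_unique:
  assumes "is_std n g \<sigma>" "is_std n g \<tau>"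
  shows "\<sigma> = \<tau>"
proof -
  have rank: "\<rho> j = card {i\<in>{1..n}. g i < g j \<or> (g i = g j \<and> i < j)} + 1"
    if \<rho>: "is_std n g \<rho>" and j: "j \<in> {1..n}" for \<rho> j
  proof -
    have p: "\<rho> permutes {1..n}" using \<rho> by (simp add: is_std_def)
    have inj: "inj_on \<rho> A" for A using permutes_inj[OF p] by (rule inj_on_subset) simp
    have mem: "\<rho> j \<in> {1..n}" using permutes_in_image[OF p] j by blast
    have eq: "{i\<in>{1..n}. g i < g j \<or> (g i = g j \<and> i < j)} = {i\<in>{1..n}. \<rho> i < \<rho> j}"
      using \<rho> j by (auto simp: is_std_def)
    have "\<rho> ` {i\<in>{1..n}. \<rho> i < \<rho> j} = {y \<in> \<rho> ` {1..n}. y < \<rho> j}" by blast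
    also have "\<dots> = {1..<\<rho> j}" unfolding permutes_image[OF p] using mem by auto
    finally have "card {i\<in>{1..n}. \<rho> i < \<rho> j} = card {1..<\<rho> j}"
      using card_image[OF inj[of "{i\<in>{1..n}. \<rho> i < \<rho> j}"]] by simp
    then show ?thesis unfolding eq using mem by simp
  qed
  have p: "\<sigma> permutes {1..n}" "\<tau> permutes {1..n}" using assms by (simp_all add: is_std_def)
  show ?thesis
  proof
    fix j show "\<sigma> j = \<tau> j"
    proof (cases "j \<in> {1..n}")
      case True
      show ?thesis unfolding rank[OF assms(1) True] rank[OF assms(2) True] ..
    next
      case False
      show ?thesis unfolding permutes_not_in[OF p(1) False] permutes_not_in[OF p(2) False] ..
    qed
  qed
qed

lemma is_std_std_perm: "is_std n g (std_perm n g)"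
proof -
  obtain \<sigma> where \<sigma>: "is_std n g \<sigma>" using is_std_ex by blast
  show ?thesis unfolding std_perm_def by (rule theI[where P = "is_std n g", OF \<sigma>]) (rule is_std_unique[OF _ \<sigma>])
qed

text \<open>A fixed point counts as a cycle of length 1.\<close>

definition num_cycles :: "nat \<Rightarrow> (nat \<Rightarrow> nat) \<Rightarrow> nat \<Rightarrow> nat" where
  "num_cycles n \<sigma> j = card {C \<in> orbit \<sigma> ` {1..n}. card C = j}"

text \<open>The word \<open>y\<close> may be empty, so the empty word is a power and there are no primitive words of length 0.\<close>

definition is_power :: "'a list \<Rightarrow> bool" where
  "is_power w \<longleftrightarrow> (\<exists>y l. l \<ge> 2 \<and> w = concat (replicate l y))"

definition primitive_words :: "'a set \<Rightarrow> nat \<Rightarrow> 'a list set" where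
  "primitive_words I k = {w. set w \<subseteq> I \<and> length w = k \<and> \<not> is_power w}"

definition conjugacy :: "('a list \<times> 'a list) set" where
  "conjugacy = {(u, v). \<exists>m. v = rotate m u}"

lemma equiv_conjugacy: "equiv UNIV (conjugacy :: ('a list \<times> 'a list) set)"
proof (rule equivI, simp)
  show "refl (conjugacy :: ('a list \<times> 'a list) set)" by (auto simp: conjugacy_def refl_on_def intro: exI[of _ 0])
  show "sym (conjugacy :: ('a list \<times> 'a list) set)"
  proof (rule symI)
    fix u v :: "'a list" assume "(u, v) \<in> conjugacy"
    then obtain m where v: "v = rotate m u" by (auto simp: conjugacy_def)
    define r where "r = m mod length u"
    have "u = rotate (length u - r) v"
    proof (cases "u = []")
      case False
      then have "r < length u" by (simp add: r_def)
      moreover have "v = rotate r u" unfolding v r_def by (rule rotate_conv_mod)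
      ultimately show ?thesis by (simp add: rotate_rotate)
    qed (simp add: v)
    then show "(v, u) \<in> conjugacy" by (auto simp: conjugacy_def)
  qed
  show "trans (conjugacy :: ('a list \<times> 'a list) set)" by (auto simp: conjugacy_def trans_def rotate_rotate)
qed

definition primitive_classes :: "'a set \<Rightarrow> nat \<Rightarrow> 'a list set set" where
  "primitive_classes I k = primitive_words I k // conjugacy"

definition word_weight :: "'a pmf \<Rightarrow> 'a list \<Rightarrow> real" where
  "word_weight p w = prod_list (map (pmf p) w)"

lemma word_weight_conjugacy: "(u, v) \<in> conjugacy \<Longrightarrow> word_weight p u = word_weight p v"
proof -
  have "mset (rotate m u) = mset u" for m
  proof (induction m)
    case (Suc m)
    have "mset (rotate1 v) = mset v" for v :: "'a list" by (cases v) simp_all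
    then show ?case using Suc by (simp add: rotate_def)
  qed simp
  then have "prod_mset (mset (map (pmf p) (rotate m u))) = prod_mset (mset (map (pmf p) u))" for m
    by (simp only: mset_map)
  then have "prod_list (map (pmf p) (rotate m u)) = prod_list (map (pmf p) u)" for m
    by (simp only: prod_mset_prod_list)
  then show "(u, v) \<in> conjugacy \<Longrightarrow> word_weight p u = word_weight p v"
    by (auto simp: conjugacy_def word_weight_def)
qed

text \<open>Convergence in distribution \<open>Y\<^sub>n \<rightarrow> Z\<close> of random vectors in \<open>\<real>\<^sup>J\<close>, \<open>J\<close> finite: \<open>E f(Y\<^sub>n) \<rightarrow> E f(Z)\<close>
  for every bounded continuous \<open>f\<close>. The library's \<^const>\<open>weak_conv_m\<close> covers \<open>\<real>\<close> only. The \<open>Y\<^sub>n\<close> may live on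
  different probability spaces and need be random vectors only for large \<open>n\<close>.\<close>

definition conv_in_distr ::
  "'i set \<Rightarrow> (nat \<Rightarrow> 'a measure) \<Rightarrow> (nat \<Rightarrow> 'a \<Rightarrow> 'i \<Rightarrow> real) \<Rightarrow> 'b measure \<Rightarrow> ('b \<Rightarrow> 'i \<Rightarrow> real) \<Rightarrow> bool" where
  "conv_in_distr J M Y N Z \<longleftrightarrow>
     (\<forall>\<^sub>F n in sequentially. Y n \<in> measurable (M n) (\<Pi>\<^sub>M i\<in>J. borel)) \<and>
     Z \<in> measurable N (\<Pi>\<^sub>M i\<in>J. borel) \<and>
     (\<forall>f. continuous_map (product_topology (\<lambda>i. euclideanreal) J) euclideanreal f \<longrightarrow>
          bounded (f ` (\<Pi>\<^sub>E i\<in>J. UNIV)) \<longrightarrow>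
          (\<lambda>n. integral\<^sup>L (M n) (\<lambda>\<omega>. f (Y n \<omega>))) \<longlonglongrightarrow> integral\<^sup>L N (\<lambda>\<omega>. f (Z \<omega>)))"

text \<open>\<open>\<Sum>\<^bsub>\<^bold>i \<in> Q\<^sub>l\<^esub> X\<^sub>\<^bold>i\<close>, the sum over the conjugacy classes of primitive words of length \<open>l\<close>. It may have
  infinitely many terms, and \<^const>\<open>infsum\<close> is 0 where it diverges.\<close>

definition class_sum :: "'a set \<Rightarrow> ('a list set \<Rightarrow> 'b \<Rightarrow> nat) \<Rightarrow> nat \<Rightarrow> 'b \<Rightarrow> real" where
  "class_sum I X l \<omega> = (\<Sum>\<^sub>\<infinity>c\<in>primitive_classes I l. real (X c \<omega>))"

end

theory Submission
  imports Defs "HOL-Combinatorics.Cycles"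
begin

text \<open>
  Attach to every position of a word the infinite periodic sequence of letters read backwards along its
  cycle in the standardization. These sequences increase lexicographically with the position, and
  from this one sees (Gessel and Reutenauer) that the multiset of the sequences determines the word and may be any
  shift-invariant multiset of size \<open>n\<close>. Such a multiset is a multiset of conjugacy classes of primitive words,
  one for each cycle. The weight of a word is multiplicative in it, so for a random word the probability
  that class \<open>c\<close> occurs at least \<open>\<mu>\<^sub>c\<close> times, for all \<open>c\<close> in a finite set, is exactly
  \<open>\<Prod> p\<^sub>c ^ \<mu>\<^sub>c\<close> as soon as \<open>n\<close> is large enough to hold all these copies. This is also the probability for
  independent geometric variables; hence for finitely many classes the multiplicities have the same law as
  the geometric variables on any finite box once \<open>n\<close> is large. The classes and values outside a
  finite box have total probability at most \<open>\<epsilon>\<close>, uniformly in \<open>n\<close>, because the weights of the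
  classes are summable.
\<close>

section \<open>Words and shift-invariant multisets of sequences\<close>

text \<open>Shift-invariant multisets of infinite sequences stand in for multisets of necklaces
  because invariance is a single equation, preserved by sums and by differences. Adding a fixed
  multiset is therefore a bijection onto the multisets that contain it, and the fact that the law of
  a shorter random word has total mass 1 replaces any generating function. If the alphabet is
  infinite, a cycle count is an infinite sum of multiplicities, and convergence of finitely many of
  them does not control it. What helps is that the formula for lower bounds fails in one direction
  only: when \<open>n\<close> is too small to hold the copies, the probability drops to 0. The
  product is thus an upper bound for every \<open>n\<close>, and the same tail estimate serves the
  random words and the limit.\<close>

definition shift :: "(nat \<Rightarrow> 'a) \<Rightarrow> nat \<Rightarrow> 'a" where
  "shift v = (\<lambda>i. v (Suc i))"

lemma funpow_shift: "(shift ^^ d) v = (\<lambda>i. v (i + d))"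
  by (induction d) (simp_all add: shift_def)

section \<open>The lexicographic order on sequences\<close>

definition lexless :: "(nat \<Rightarrow> 'a::linorder) \<Rightarrow> (nat \<Rightarrow> 'a) \<Rightarrow> bool" where
  "lexless u v \<longleftrightarrow> (\<exists>i. (\<forall>j<i. u j = v j) \<and> u i < v i)"

lemma lexless_irrefl: "\<not> lexless u u"
  by (simp add: lexless_def)

lemma lexless_trans: "lexless u v \<Longrightarrow> lexless v w \<Longrightarrow> lexless u w"
proof -
  assume "lexless u v" "lexless v w"
  then obtain i k where i: "\<forall>j<i. u j = v j" "u i < v i" and k: "\<forall>j<k. v j = w j" "v k < w k"
    by (auto simp: lexless_def)
  have "\<forall>j<min i k. u j = w j" using i k by simp
  moreover have "u (min i k) < w (min i k)"
    using i k by (cases i k rule: linorder_cases) (auto simp: min_def)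
  ultimately show ?thesis unfolding lexless_def by blast
qed

lemma lexless_total: "u \<noteq> v \<Longrightarrow> lexless u v \<or> lexless v u"
proof -
  assume "u \<noteq> v"
  then have ex: "\<exists>i. u i \<noteq> v i" by auto
  define i where "i = (LEAST i. u i \<noteq> v i)"
  have "u i \<noteq> v i" unfolding i_def using ex by (rule LeastI_ex)
  moreover have "\<forall>j<i. u j = v j" unfolding i_def using not_less_Least by blast
  ultimately show ?thesis unfolding lexless_def by (metis linorder_neqE)
qed

lemma lexless_shift: "u 0 = v 0 \<Longrightarrow> lexless (shift u) (shift v) \<longleftrightarrow> lexless u v"
proof
  assume eq: "u 0 = v 0"
  { assume "lexless (shift u) (shift v)"
    then obtain i where i: "\<forall>j<i. u (Suc j) = v (Suc j)" "u (Suc i) < v (Suc i)"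
      by (auto simp: lexless_def shift_def)
    have "\<forall>j<Suc i. u j = v j" using i(1) eq less_Suc_eq_0_disj by auto
    then show "lexless u v" using i(2) unfolding lexless_def by blast }
  { assume "lexless u v"
    then obtain i where i: "\<forall>j<i. u j = v j" "u i < v i"
      by (auto simp: lexless_def)
    then obtain k where "i = Suc k" using eq by (cases i) auto
    then show "lexless (shift u) (shift v)" using i
      unfolding lexless_def shift_def by (intro exI[of _ k]) auto }
qed

text \<open>By insertion: \<open>v\<close> goes after everything smaller and before the rest.
  Sortedness is the absence of inversions, so that equal sequences, which come from several cycles
  spelling the same class, may stand side by side.\<close>

lemma ex_lex_sorted:
  fixes M :: "(nat \<Rightarrow> 'a::linorder) multiset"
  shows "\<exists>us. mset us = M \<and> sorted_wrt (\<lambda>u v. \<not> lexless v u) us"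
proof (induction M)
  case (add v M)
  then obtain us where us: "mset us = M" "sorted_wrt (\<lambda>u v. \<not> lexless v u) us" by blast
  define a where "a = filter (\<lambda>u. lexless u v) us"
  define b where "b = filter (\<lambda>u. \<not> lexless u v) us"
  have "mset (a @ v # b) = add_mset v M"
    using us(1) by (simp add: a_def b_def multiset_partition[symmetric])
  moreover have "sorted_wrt (\<lambda>u v. \<not> lexless v u) (a @ v # b)"
    unfolding sorted_wrt_append using us(2)
    by (auto simp: a_def b_def sorted_wrt_filter dest: lexless_trans)
      (metis lexless_irrefl lexless_trans)
  ultimately show ?case by blast
qed simp

lemma count_image_mset_set:
  "finite A \<Longrightarrow> count (image_mset f (mset_set A)) v = card {y \<in> A. f y = v}"
proof -
  assume A: "finite A"
  have count_eq: "count (image_mset f M) v = size (filter_mset (\<lambda>y. f y = v) M)" for M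
    by (induction M) auto
  have "count (image_mset f (mset_set A)) v = size (filter_mset (\<lambda>y. f y = v) (mset_set A))"
    by (rule count_eq)
  also have "\<dots> = card {y \<in> A. f y = v}" using A by simp
  finally show ?thesis .
qed

text \<open>Take the first position \<open>x\<close> where the arrangements differ and let
  \<open>w\<close> be the one with the smaller value there. In the other arrangement all copies of
  \<open>w x\<close> lie before \<open>x\<close>, where both agree, so \<open>w\<close> has at least
  one copy more, against the equality of the multisets.\<close>

lemma lex_sorted_unique:
  fixes u u' :: "nat \<Rightarrow> nat \<Rightarrow> 'a::linorder"
  assumes u: "\<And>x y. x \<in> {1..n} \<Longrightarrow> y \<in> {1..n} \<Longrightarrow> x < y \<Longrightarrow> \<not> lexless (u y) (u x)"
    and u': "\<And>x y. x \<in> {1..n} \<Longrightarrow> y \<in> {1..n} \<Longrightarrow> x < y \<Longrightarrow> \<not> lexless (u' y) (u' x)"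
    and eq: "image_mset u (mset_set {1..n}) = image_mset u' (mset_set {1..n})"
    and x: "x \<in> {1..n}"
  shows "u x = u' x"
  using x
proof (induction x rule: less_induct)
  case (less x)
  have *: False
    if mono: "\<And>x y. x \<in> {1..n} \<Longrightarrow> y \<in> {1..n} \<Longrightarrow> x < y \<Longrightarrow> \<not> lexless (w' y) (w' x)"
      and eq: "image_mset w (mset_set {1..n}) = image_mset w' (mset_set {1..n})"
      and prev: "\<And>y. y < x \<Longrightarrow> y \<in> {1..n} \<Longrightarrow> w y = w' y"
      and lt: "lexless (w x) (w' x)" for w w' :: "nat \<Rightarrow> nat \<Rightarrow> 'a"
  proof -
    have sub: "{y \<in> {1..n}. w' y = w x} \<subseteq> {y \<in> {1..n}. w y = w x} - {x}"
    proof (intro subsetI)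
      fix y assume "y \<in> {y \<in> {1..n}. w' y = w x}"
      then have y: "y \<in> {1..n}" "w' y = w x" by auto
      have "y < x"
      proof (rule ccontr)
        assume "\<not> y < x"
        then show False using mono[OF less.prems y(1)] lt y(2) lexless_irrefl
          by (metis linorder_neqE_nat)
      qed
      then show "y \<in> {y \<in> {1..n}. w y = w x} - {x}" using prev[of y] y by simp
    qed
    have "card {y \<in> {1..n}. w' y = w x} < card {y \<in> {1..n}. w y = w x}"
      by (rule psubset_card_mono) (use sub less.prems in auto)
    then show False
      using arg_cong[OF eq, of "\<lambda>M. count M (w x)"] by (simp add: count_image_mset_set)
  qed
  show ?case
  proof (rule ccontr)
    assume "u x \<noteq> u' x"
    then consider "lexless (u x) (u' x)" | "lexless (u' x) (u x)" using lexless_total by blast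
    then show False
    proof cases
      case 1 show ?thesis by (rule *[OF u' eq _ 1]) (use less.IH in auto)
    next
      case 2 show ?thesis by (rule *[OF u eq[symmetric] _ 2]) (use less.IH in auto)
    qed
  qed
qed

text \<open>The letters met going backwards along the cycle of \<^term>\<open>x\<close>, from the predecessor of \<^term>\<open>x\<close> on: then
  the sequence at \<open>\<sigma> x\<close> is the one at \<open>x\<close> with the letter \<open>g x\<close> put in front, and the definition of the
  standardization says exactly that these sequences increase lexicographically with the position.\<close>

definition past :: "nat \<Rightarrow> (nat \<Rightarrow> real) \<Rightarrow> nat \<Rightarrow> nat \<Rightarrow> real" where
  "past n g x = (\<lambda>i. g ((inv (std_perm n g) ^^ Suc i) x))"

definition past_mset :: "nat \<Rightarrow> (nat \<Rightarrow> real) \<Rightarrow> (nat \<Rightarrow> real) multiset" where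
  "past_mset n g = image_mset (past n g) (mset_set {1..n})"

text \<open>On a finite multiset the equation makes \<open>shift\<close> permute the support and
  preserve multiplicities; in particular every sequence that occurs is periodic.\<close>

definition shift_inv_msets :: "nat \<Rightarrow> (nat \<Rightarrow> 'a) multiset set" where
  "shift_inv_msets n = {M. size M = n \<and> image_mset shift M = M}"

lemma std_perm_permutes: "std_perm n g permutes {1..n}"
  using is_std_std_perm by (auto simp: is_std_def)

lemma std_perm_less_iff:
  "j \<in> {1..n} \<Longrightarrow> k \<in> {1..n} \<Longrightarrow>
    std_perm n g j < std_perm n g k \<longleftrightarrow> g j < g k \<or> (g j = g k \<and> j < k)"
  using is_std_std_perm[of n g] by (auto simp: is_std_def)

lemma inv_std_perm_permutes: "inv (std_perm n g) permutes {1..n}"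
  by (rule permutes_inv[OF std_perm_permutes])

lemma inv_std_perm_in: "x \<in> {1..n} \<Longrightarrow> inv (std_perm n g) x \<in> {1..n}"
  using permutes_in_image[OF inv_std_perm_permutes] by blast

lemma funpow_inv_std_perm_in: "x \<in> {1..n} \<Longrightarrow> (inv (std_perm n g) ^^ i) x \<in> {1..n}"
proof (induction i)
  case (Suc i)
  then show ?case using inv_std_perm_in by (metis comp_apply funpow.simps(2))
qed simp

lemma less_iff_inv_std_perm:
  fixes g
  assumes "x \<in> {1..n}" "y \<in> {1..n}"
  defines "\<tau> \<equiv> inv (std_perm n g)"
  shows "x < y \<longleftrightarrow> g (\<tau> x) < g (\<tau> y) \<or> (g (\<tau> x) = g (\<tau> y) \<and> \<tau> x < \<tau> y)"
  using std_perm_less_iff[of "\<tau> x" n "\<tau> y" g] inv_std_perm_in[OF assms(1)] inv_std_perm_in[OF assms(2)]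
  by (simp add: \<tau>_def permutes_inverses[OF std_perm_permutes])

lemma shift_past: "shift (past n g x) = past n g (inv (std_perm n g) x)"
  by (simp add: shift_def past_def funpow_swap1 del: funpow.simps(2)) (simp add: funpow_swap1)

lemma funpow_shift_past: "(shift ^^ d) (past n g x) = past n g ((inv (std_perm n g) ^^ d) x)"
  by (induction d) (simp_all add: shift_past)

lemma funpow_inv_std_perm_less_iff:
  fixes g n
  assumes "x \<in> {1..n}" "y \<in> {1..n}"
  defines "\<tau> \<equiv> inv (std_perm n g)"
  shows "(\<tau> ^^ i) x < (\<tau> ^^ i) y \<longleftrightarrow> past n g x i < past n g y i \<or>
    (past n g x i = past n g y i \<and> (\<tau> ^^ Suc i) x < (\<tau> ^^ Suc i) y)"
  unfolding \<tau>_def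
  using less_iff_inv_std_perm[OF funpow_inv_std_perm_in[OF assms(1)] funpow_inv_std_perm_in[OF assms(2)], where g = g]
  by (simp add: past_def)

text \<open>As long as the letters read backwards agree, the order of the positions is preserved, because
  ties are broken by position.\<close>

lemma inv_std_perm_less_of_past_eq:
  assumes "x \<in> {1..n}" "y \<in> {1..n}" "x < y" "\<forall>j<i. past n g x j = past n g y j"
  shows "(inv (std_perm n g) ^^ i) x < (inv (std_perm n g) ^^ i) y"
  using assms(4)
proof (induction i)
  case (Suc i)
  have "(inv (std_perm n g) ^^ i) x < (inv (std_perm n g) ^^ i) y" using Suc by simp
  moreover have "past n g x i = past n g y i" using Suc.prems by simp
  ultimately show ?case
    using funpow_inv_std_perm_less_iff[OF assms(1,2)]
    by (simp add: past_def)
qed (use assms in simp)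

text \<open>At the first index where the sequences differ, the backward iterates are still ordered
  like \<open>x\<close> and \<open>y\<close>, and the standardization never places a larger letter
  before a smaller one.\<close>

lemma past_mono:
  assumes "x \<in> {1..n}" "y \<in> {1..n}" "x < y"
  shows "\<not> lexless (past n g y) (past n g x)"
proof
  assume "lexless (past n g y) (past n g x)"
  then obtain i where i: "\<forall>j<i. past n g y j = past n g x j" "past n g y i < past n g x i"
    by (auto simp: lexless_def)
  have "(inv (std_perm n g) ^^ i) x < (inv (std_perm n g) ^^ i) y"
    using inv_std_perm_less_of_past_eq[OF assms] i(1) by simp
  then have "past n g x i \<le> past n g y i"
    using funpow_inv_std_perm_less_iff[OF assms(1,2)]
    by (auto simp: past_def)
  then show False using i(2) by simp
qed

lemma funpow_inv_std_perm_fixed: "\<exists>N>0. (inv (std_perm n g) ^^ N) = id"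
proof -
  have "permutation (inv (std_perm n g))"
    using inv_std_perm_permutes unfolding permutation_permutes by blast
  then show ?thesis using permutation_is_nilpotent by blast
qed

lemma funpow_mult_eq_id: "f ^^ N = id \<Longrightarrow> f ^^ (N * d) = id"
  by (simp add: funpow_mult[symmetric])

text \<open>If two positions on one cycle had the same sequence, the order-preserving map that takes one to the
  other would move positions up for ever. This is why the cycles spell primitive words.\<close>

lemma past_injective:
  assumes "x \<in> {1..n}" "y \<in> {1..n}" "past n g x = past n g y" "y = (inv (std_perm n g) ^^ d) x"
  shows "x = y"
proof -
  define \<tau> where "\<tau> = inv (std_perm n g)"
  obtain N where N: "N > 0" "\<tau> ^^ N = id" using funpow_inv_std_perm_fixed \<tau>_def by blast
  have period: "(\<tau> ^^ (N * d)) z = z" for z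
    using funpow_mult_eq_id[OF N(2)] by simp
  have in_range: "(\<tau> ^^ i) x \<in> {1..n}" for i
    unfolding \<tau>_def by (rule funpow_inv_std_perm_in[OF assms(1)])
  have iter: "R ((\<tau> ^^ (j * d)) x) ((\<tau> ^^ (Suc j * d)) x)"
    if "R x y" "\<And>i. R x y \<Longrightarrow> R ((\<tau> ^^ i) x) ((\<tau> ^^ i) y)" for R j
  proof -
    have "R ((\<tau> ^^ (j * d)) x) ((\<tau> ^^ (j * d)) y)" using that by blast
    then show ?thesis by (simp add: assms(4) funpow_add add.commute flip: \<tau>_def)
        (metis comp_apply funpow_add add.commute)
  qed
  \<comment> \<open>\<open>R\<close> is \<open><\<close> or \<open>>\<close>. It chains by
    transitivity along \<open>x\<close>, \<open>(\<tau> ^^ d) x\<close>,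
    \<open>(\<tau> ^^ (2 * d)) x\<close>, and so on, and after \<open>N\<close> steps the chain is
    back at \<open>x\<close>.\<close>
  have no: False if R: "R x y" "\<And>i. R x y \<Longrightarrow> R ((\<tau> ^^ i) x) ((\<tau> ^^ i) y)"
    and tr: "\<And>a b c. R a b \<Longrightarrow> R b c \<Longrightarrow> R a c" and ir: "\<And>a. \<not> R a a" for R :: "nat \<Rightarrow> nat \<Rightarrow> bool"
  proof -
    have "R x ((\<tau> ^^ (Suc j * d)) x)" for j
    proof (induction j)
      case 0 then show ?case using iter[OF R, of 0] by simp
    next
      case (Suc j) then show ?case using iter[OF R, of "Suc j"] tr by blast
    qed
    from this[of "N - 1"] show False using N(1) period ir by simp
  qed
  show ?thesis
  proof (rule ccontr)
    assume "x \<noteq> y"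
    then consider "x < y" | "y < x" by linarith
    then show False
    proof cases
      case 1
      then show False
        by (rule no[of "(<)"]) (use inv_std_perm_less_of_past_eq[OF assms(1,2)] assms(3) \<tau>_def in auto)
    next
      case 2
      then show False
        by (rule no[of "(>)"]) (use inv_std_perm_less_of_past_eq[OF assms(2,1)] assms(3) \<tau>_def in auto)
    qed
  qed
qed

lemma image_mset_permutes:
  "finite A \<Longrightarrow> \<pi> permutes A \<Longrightarrow> image_mset (\<lambda>x. f (\<pi> x)) (mset_set A) = image_mset f (mset_set A)"
proof -
  assume A: "finite A" "\<pi> permutes A"
  have "image_mset (\<lambda>x. f (\<pi> x)) (mset_set A) = image_mset f (image_mset \<pi> (mset_set A))"
    by (simp add: image_mset.compositionality comp_def)
  also have "image_mset \<pi> (mset_set A) = mset_set A"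
    by (subst image_mset_mset_set[OF permutes_inj_on[OF A(2)]]) (simp add: permutes_image[OF A(2)])
  finally show ?thesis .
qed

lemma past_mset_shift_inv: "past_mset n g \<in> shift_inv_msets n"
  by (simp add: shift_inv_msets_def past_mset_def image_mset.compositionality comp_def shift_past
      image_mset_permutes[OF _ inv_std_perm_permutes] del: One_nat_def)

text \<open>Sorting the multiset recovers the sequence at each position, and \<open>g x\<close> is
  the letter met when the cycle of \<open>x\<close> has been read once round. Extensionality fixes
  the values outside \<open>{1..n}\<close>.\<close>

lemma past_mset_inj: "inj_on (past_mset n) ({1..n} \<rightarrow>\<^sub>E UNIV)"
proof (rule inj_onI)
  fix g h assume g: "g \<in> {1..n} \<rightarrow>\<^sub>E UNIV" and h: "h \<in> {1..n} \<rightarrow>\<^sub>E UNIV"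
    and eq: "past_mset n g = past_mset n h"
  have past: "past n g x = past n h x" if "x \<in> {1..n}" for x
    by (rule lex_sorted_unique[OF past_mono past_mono _ that])
      (use eq in \<open>simp_all add: past_mset_def\<close>)
  show "g = h"
  proof (rule PiE_ext[OF g h])
    fix x assume x: "x \<in> {1..n}"
    obtain N K where N: "N > 0" "(inv (std_perm n g) ^^ N) = id"
      and K: "K > 0" "(inv (std_perm n h) ^^ K) = id" using funpow_inv_std_perm_fixed by metis
    have eqs: "(inv (std_perm n g) ^^ (N * K)) x = x" "(inv (std_perm n h) ^^ (N * K)) x = x"
      using funpow_mult_eq_id[OF N(2), of K] funpow_mult_eq_id[OF K(2), of N] by (simp_all add: mult.commute)
    \<comment> \<open>\<open>N * K\<close> is a common period of both inverse permutations. Index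
      \<open>N * K - 1\<close> is the letter \<open>N * K\<close> steps before \<open>x\<close>,
      that is, at \<open>x\<close> itself.\<close>
    have "N * K = Suc (N * K - 1)" using N(1) K(1) by simp
    then have "past n g x (N * K - 1) = g x" "past n h x (N * K - 1) = h x"
      unfolding past_def using eqs by metis+
    then show "g x = h x" using past[OF x] by simp
  qed
qed

text \<open>The word with a given multiset: sort the multiset as \<open>u 1, \<dots>, u n\<close> and let \<open>g x\<close> be the letter
  preceding \<open>u x\<close> on its shift orbit. Stably sorting the \<open>g x # u x\<close>, again the whole multiset, is what
  the standardization does.\<close>

lemma past_mset_surj:
  assumes M: "M \<in> shift_inv_msets n"
  shows "\<exists>g \<in> {1..n} \<rightarrow>\<^sub>E UNIV. past_mset n g = M"
proof -
  obtain us where us: "mset us = M" "sorted_wrt (\<lambda>u v. \<not> lexless v u) us"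
    using ex_lex_sorted by blast
  have len: "length us = n" using us M by (auto simp: shift_inv_msets_def)
  define u where "u x = us ! (x - 1)" for x
  have u_mset: "image_mset u (mset_set {1..n}) = M"
  proof -
    have "image_mset u (mset_set {1..n}) = mset (map u [1..<Suc n])"
      by (simp only: mset_map mset_upt) (simp add: atLeastLessThanSuc_atLeastAtMost)
    also have "map u [1..<Suc n] = us"
      by (rule nth_equalityI) (simp_all add: len u_def del: upt_Suc)
    finally show ?thesis using us(1) by simp
  qed
  have u_mono: "\<not> lexless (u y) (u x)" if "x \<in> {1..n}" "y \<in> {1..n}" "x < y" for x y
    using sorted_wrt_nth_less[OF us(2), of "x - 1" "y - 1"] that len by (auto simp: u_def)
  \<comment> \<open>A map of a finite set onto itself is injective, so \<open>shift\<close> has an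
    inverse \<open>pre\<close> on the support.\<close>
  have surj: "shift ` set_mset M = set_mset M"
    using M by (metis (mono_tags, lifting) mem_Collect_eq set_image_mset shift_inv_msets_def)
  then have inj: "inj_on shift (set_mset M)"
    by (simp add: eq_card_imp_inj_on)
  define pre where "pre = the_inv_into (set_mset M) shift"
  have pre_shift: "pre (shift v) = v" if "v \<in># M" for v
    unfolding pre_def using the_inv_into_f_f[OF inj that] .
  have shift_pre: "shift (pre v) = v" if "v \<in># M" for v
    unfolding pre_def using f_the_inv_into_f[OF inj] that surj by blast
  have "image_mset pre M = image_mset pre (image_mset shift M)"
    using M by (simp add: shift_inv_msets_def)
  also have "\<dots> = image_mset (\<lambda>v. v) M"
    unfolding image_mset.compositionality by (rule image_mset_cong) (simp add: pre_shift)
  finally have pre_mset: "image_mset pre M = M" by simp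
  have u_in: "u x \<in># M" if "x \<in> {1..n}" for x
    using that unfolding u_mset[symmetric] by simp
  define g where "g = (\<lambda>x\<in>{1..n}. pre (u x) 0)"
  define \<tau> where "\<tau> = inv (std_perm n g)"
  have \<tau>_in: "\<tau> x \<in> {1..n}" if "x \<in> {1..n}" for x
    unfolding \<tau>_def by (rule inv_std_perm_in[OF that])
  \<comment> \<open>Both sides arrange the multiset \<open>M\<close>, so by uniqueness it remains to
    see that the left one is sorted. Smaller first letters stand earlier by the choice of
    \<open>\<tau>\<close>; for equal first letters the comparison passes to the tails
    \<open>u (\<tau> x)\<close>, which are sorted.\<close>
  have u_\<tau>: "pre (u (\<tau> x)) = u x" if x: "x \<in> {1..n}" for x
  proof (rule lex_sorted_unique[OF _ u_mono _ x, where u = "\<lambda>x. pre (u (\<tau> x))"])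
    show "image_mset (\<lambda>x. pre (u (\<tau> x))) (mset_set {1..n}) = image_mset u (mset_set {1..n})"
      using pre_mset u_mset image_mset_permutes[OF _ inv_std_perm_permutes, of n "\<lambda>x. pre (u x)" g]
      by (simp add: \<tau>_def image_mset.compositionality comp_def flip: u_mset)
    fix x y assume xy: "x \<in> {1..n}" "y \<in> {1..n}" "x < y"
    have g_eq: "g (\<tau> x) = pre (u (\<tau> x)) 0" "g (\<tau> y) = pre (u (\<tau> y)) 0"
      using \<tau>_in xy by (simp_all add: g_def)
    show "\<not> lexless (pre (u (\<tau> y))) (pre (u (\<tau> x)))"
    proof
      assume less: "lexless (pre (u (\<tau> y))) (pre (u (\<tau> x)))"
      then have "\<not> pre (u (\<tau> x)) 0 < pre (u (\<tau> y)) 0"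
        unfolding lexless_def by (metis not_less_iff_gr_or_eq gr0I)
      then have eq: "pre (u (\<tau> y)) 0 = pre (u (\<tau> x)) 0" and lt: "\<tau> x < \<tau> y"
        using less_iff_inv_std_perm[OF xy(1,2), where g = g] xy(3) g_eq by (auto simp: \<tau>_def)
      have "lexless (u (\<tau> y)) (u (\<tau> x))"
        using lexless_shift[of "pre (u (\<tau> y))" "pre (u (\<tau> x))", OF eq] less shift_pre[OF u_in] \<tau>_in xy by simp
      then show False using u_mono[OF \<tau>_in \<tau>_in lt] xy by blast
    qed
  qed
  have u_0: "u x 0 = g (\<tau> x)" if "x \<in> {1..n}" for x
    using u_\<tau>[OF that] \<tau>_in[OF that] by (simp add: g_def)
  have u_Suc: "u x (Suc i) = u (\<tau> x) i" if "x \<in> {1..n}" for x i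
    using shift_pre[OF u_in[OF \<tau>_in[OF that]]] u_\<tau>[OF that] by (metis shift_def)
  have "past n g x i = u x i" if "x \<in> {1..n}" for x i
    using that
  proof (induction i arbitrary: x)
    case 0 then show ?case by (simp add: past_def u_0 \<tau>_def)
  next
    case (Suc i)
    have "past n g x (Suc i) = past n g (\<tau> x) i"
      using fun_cong[OF shift_past[of n g x], of i] by (simp add: shift_def \<tau>_def)
    then show ?case using Suc.IH[OF \<tau>_in] Suc.prems u_Suc by simp
  qed
  then have "past_mset n g = image_mset u (mset_set {1..n})"
    unfolding past_mset_def by (intro image_mset_cong) auto
  then show ?thesis using u_mset by (intro bexI[of _ g]) (auto simp: g_def)
qed

section \<open>The law of the multiset attached to a random word\<close>

definition mset_weight :: "'a pmf \<Rightarrow> (nat \<Rightarrow> 'a) multiset \<Rightarrow> real" where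
  "mset_weight p M = (\<Prod>v\<in>#M. pmf p (v 0))"

text \<open>The default \<open>undefined\<close> places the support inside the extensional
  functions, where \<open>past_mset n\<close> is injective.\<close>

definition iid_words :: "nat \<Rightarrow> 'a pmf \<Rightarrow> (nat \<Rightarrow> 'a) pmf" where
  "iid_words n p = Pi_pmf {1..n} undefined (\<lambda>_. p)"

lemma set_iid_words: "set_pmf (iid_words n p) = {1..n} \<rightarrow>\<^sub>E set_pmf p"
  by (auto simp: iid_words_def set_Pi_pmf PiE_dflt_def PiE_def extensional_def)

lemma pmf_iid_words: "g \<in> {1..n} \<rightarrow>\<^sub>E UNIV \<Longrightarrow> pmf (iid_words n p) g = (\<Prod>x\<in>{1..n}. pmf p (g x))"
  unfolding iid_words_def by (rule pmf_Pi') (auto simp: PiE_def extensional_def)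

lemma mset_weight_nonneg: "mset_weight p M \<ge> 0"
  by (induction M) (simp_all add: mset_weight_def)

lemma mset_weight_union: "mset_weight p (K + M) = mset_weight p K * mset_weight p M"
  by (simp add: mset_weight_def)

text \<open>The first letters of the attached sequences are the letters of the word in another
  order, so a weight that looks only at first letters is the probability of the word.\<close>

lemma mset_weight_past_mset: "mset_weight p (past_mset n g) = (\<Prod>x\<in>{1..n}. pmf p (g x))"
proof -
  have "mset_weight p (past_mset n g) = (\<Prod>x\<in>#image_mset (\<lambda>x. g (inv (std_perm n g) x)) (mset_set {1..n}). pmf p x)"
    by (simp add: mset_weight_def past_mset_def image_mset.compositionality comp_def past_def)
  also have "\<dots> = (\<Prod>x\<in>{1..n}. pmf p (g x))"
    by (simp add: image_mset_permutes[OF _ inv_std_perm_permutes] image_mset.compositionality comp_def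
        prod_unfold_prod_mset del: One_nat_def)
  finally show ?thesis .
qed

lemma pmf_past_mset:
  "pmf (map_pmf (past_mset n) (iid_words n p)) M = (if M \<in> shift_inv_msets n then mset_weight p M else 0)"
proof (cases "M \<in> shift_inv_msets n")
  case True
  then obtain g where g: "g \<in> {1..n} \<rightarrow>\<^sub>E UNIV" "past_mset n g = M"
    using past_mset_surj by blast
  have "pmf (map_pmf (past_mset n) (iid_words n p)) M =
      measure (iid_words n p) (past_mset n -` {M} \<inter> set_pmf (iid_words n p))"
    by (simp add: pmf_map measure_Int_set_pmf)
  \<comment> \<open>The fibre also contains functions that are not extensional; the support removes
    them. It may remove \<open>g\<close> as well, and then the weight of \<open>M\<close> is
    0.\<close>
  also have "past_mset n -` {M} \<inter> set_pmf (iid_words n p) = {g} \<inter> set_pmf (iid_words n p)"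
    using g inj_onD[OF past_mset_inj, of n _ g] unfolding set_iid_words by fastforce
  also have "measure (iid_words n p) ({g} \<inter> set_pmf (iid_words n p)) = pmf (iid_words n p) g"
    by (simp add: measure_Int_set_pmf pmf.rep_eq)
  also have "\<dots> = mset_weight p M"
    using pmf_iid_words[OF g(1)] mset_weight_past_mset[of p n g] g(2) by simp
  finally show ?thesis using True by simp
next
  case False
  then have "past_mset n -` {M} = {}" using past_mset_shift_inv by auto
  then show ?thesis using False by (simp add: pmf_map)
qed

lemma shift_inv_msets_add:
  "K \<in> shift_inv_msets m \<Longrightarrow> M \<in> shift_inv_msets n \<Longrightarrow> K + M \<in> shift_inv_msets (m + n)"
  by (simp add: shift_inv_msets_def)

lemma shift_inv_msets_diff:
  "K \<in> shift_inv_msets m \<Longrightarrow> M \<in> shift_inv_msets n \<Longrightarrow> K \<subseteq># M \<Longrightarrow> M - K \<in> shift_inv_msets (n - m)"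
  by (auto simp: shift_inv_msets_def image_mset_Diff size_Diff_submset)

text \<open>Since the weight is multiplicative, the multisets containing \<^term>\<open>K\<close> have the weight of \<^term>\<open>K\<close> times the total
  weight, which is 1, of the multisets of size \<^term>\<open>n - m\<close>.\<close>

lemma prob_submset_past_mset:
  assumes K: "K \<in> shift_inv_msets m"
  shows "measure_pmf.prob (iid_words n p) {g. K \<subseteq># past_mset n g} = (if m \<le> n then mset_weight p K else 0)"
proof (cases "m \<le> n")
  case True
  define r where "r n = map_pmf (past_mset n) (iid_words n p)" for n
  have supp: "pmf (r n) M = 0" if "M \<notin> shift_inv_msets n" for n M
    using that unfolding r_def pmf_past_mset by simp
  have bij: "bij_betw ((+) K) (shift_inv_msets (n - m)) {M \<in> shift_inv_msets n. K \<subseteq># M}"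
    by (rule bij_betw_byWitness[where f' = "\<lambda>M. M - K"])
      (use shift_inv_msets_add[OF K, of _ "n - m"] shift_inv_msets_diff[OF K, of _ n] True in auto)
  have "emeasure (iid_words n p) {g. K \<subseteq># past_mset n g} = emeasure (r n) {M. K \<subseteq># M}"
    by (simp add: r_def vimage_def)
  also have "\<dots> = (\<integral>\<^sup>+M. pmf (r n) M \<partial>count_space {M. K \<subseteq># M})"
    by (rule nn_integral_pmf[symmetric])
  also have "\<dots> = (\<integral>\<^sup>+M. pmf (r n) M \<partial>count_space {M \<in> shift_inv_msets n. K \<subseteq># M})"
    by (rule nn_integral_count_space_eq) (auto simp: supp)
  also have "\<dots> = (\<integral>\<^sup>+M. pmf (r n) (K + M) \<partial>count_space (shift_inv_msets (n - m)))"
    by (rule nn_integral_bij_count_space[OF bij, symmetric])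
  also have "\<dots> = (\<integral>\<^sup>+M. ennreal (mset_weight p K) * pmf (r (n - m)) M \<partial>count_space (shift_inv_msets (n - m)))"
  proof (rule nn_integral_cong)
    fix M assume "M \<in> space (count_space (shift_inv_msets (n - m)) :: (nat \<Rightarrow> real) multiset measure)"
    then have M: "M \<in> shift_inv_msets (n - m)" by simp
    have "K + M \<in> shift_inv_msets n" using shift_inv_msets_add[OF K M] True by simp
    then show "ennreal (pmf (r n) (K + M)) = ennreal (mset_weight p K) * ennreal (pmf (r (n - m)) M)"
      using M by (simp add: r_def pmf_past_mset mset_weight_union ennreal_mult mset_weight_nonneg)
  qed
  also have "\<dots> = mset_weight p K * (\<integral>\<^sup>+M. pmf (r (n - m)) M \<partial>count_space UNIV)"
    by (simp add: nn_integral_cmult)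
      (rule arg_cong[where f = "(*) _"], rule nn_integral_count_space_eq, auto simp: supp)
  also have "\<dots> = mset_weight p K"
    by (simp add: nn_integral_pmf)
  finally show ?thesis
    using True by (simp add: measure_pmf.emeasure_eq_measure mset_weight_nonneg)
next
  case False
  have "\<not> K \<subseteq># past_mset n g" for g
    using size_mset_mono[of K "past_mset n g"] K past_mset_shift_inv[of n g] False
    by (auto simp: shift_inv_msets_def)
  then show ?thesis using False by simp
qed

section \<open>Conjugacy classes of primitive words\<close>

definition cyc :: "'a list \<Rightarrow> nat \<Rightarrow> 'a" where
  "cyc w i = w ! (i mod length w)"

lemma cyc_periodic: "(shift ^^ length w) (cyc w) = cyc w"
  by (rule ext) (simp add: funpow_shift cyc_def)

lemma map_cyc: "map (cyc w) [0..<length w] = w"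
  by (rule nth_equalityI) (simp_all add: cyc_def)

lemma cyc_rotate: "w \<noteq> [] \<Longrightarrow> cyc (rotate m w) = (shift ^^ m) (cyc w)"
  by (rule ext) (simp add: funpow_shift cyc_def nth_rotate mod_add_right_eq add.commute)

lemma map_upt_periodic:
  assumes "\<And>i. f (i + d) = f i"
  shows "map f [0..<l * d] = concat (replicate l (map f [0..<d]))"
proof (induction l)
  case (Suc l)
  have "map f [0..<Suc l * d] = map f [0..<d] @ map f [d..<d + l * d]"
    by (simp add: upt_add_eq_append[of 0 d "l * d"])
  also have "map f [d..<d + l * d] = map f [0..<l * d]"
    by (rule nth_equalityI) (use assms in \<open>simp_all add: add.commute\<close>)
  finally show ?case using Suc by simp
qed simp

lemma nth_concat_replicate:
  "j < l * length y \<Longrightarrow> concat (replicate l y) ! j = y ! (j mod length y)"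
proof (induction l arbitrary: j)
  case (Suc l)
  show ?case
  proof (cases "j < length y")
    case False
    then have "concat (replicate l y) ! (j - length y) = y ! ((j - length y) mod length y)"
      using Suc by simp
    then show ?thesis using False by (simp add: nth_append le_mod_geq)
  qed (simp add: nth_append)
qed simp

lemma least_power_shift:
  assumes "(shift ^^ N) v = v" "N > 0"
  shows "(shift ^^ m) v = v \<longleftrightarrow> least_power shift v dvd m"
proof
  assume "least_power shift v dvd m"
  then obtain k where k: "m = least_power shift v * k" by blast
  have "(shift ^^ (least_power shift v * k)) v = v"
    by (induction k) (use least_powerI(1)[OF assms] in \<open>simp_all add: funpow_add\<close>)
  then show "(shift ^^ m) v = v" by (simp add: k)
qed (rule least_power_minimal)

lemma not_power_Nil: "\<not> is_power w \<Longrightarrow> w \<noteq> []"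
  by (force simp: is_power_def)

text \<open>The least period \<open>d\<close> divides the length of \<open>w\<close>, so
  \<open>w\<close> is a repetition of its first \<open>d\<close> letters; primitivity leaves only
  the exponent 1.\<close>

lemma least_power_cyc:
  assumes "\<not> is_power w"
  shows "least_power shift (cyc w) = length w"
proof -
  define d where "d = least_power shift (cyc w)"
  have pos: "length w > 0" using not_power_Nil[OF assms] by simp
  have d: "d > 0" "(shift ^^ d) (cyc w) = cyc w"
    using least_powerI[OF cyc_periodic pos] by (simp_all add: d_def)
  have "d dvd length w"
    unfolding d_def by (rule least_power_minimal[OF cyc_periodic])
  then obtain l where l: "length w = l * d" by (metis dvdE mult.commute)
  have "cyc w (i + d) = cyc w i" for i
    using fun_cong[OF d(2), of i] by (simp add: funpow_shift)
  then have "map (cyc w) [0..<length w] = concat (replicate l (map (cyc w) [0..<d]))"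
    unfolding l by (rule map_upt_periodic)
  then have "w = concat (replicate l (map (cyc w) [0..<d]))" by (simp add: map_cyc)
  then have "\<not> l \<ge> 2" using assms unfolding is_power_def by blast
  then have "l = 1" using l pos by (cases l) auto
  then show ?thesis using l d_def by simp
qed

lemma cyc_map_upt:
  assumes "(shift ^^ l) v = v" "l > 0"
  shows "cyc (map v [0..<l]) = v"
proof
  fix i
  have per: "v (j + l * k) = v j" for j k
  proof (induction k)
    case (Suc k)
    have "v (j + l * Suc k) = v ((j + l * k) + l)" by (simp add: algebra_simps)
    also have "\<dots> = v (j + l * k)"
      using fun_cong[OF assms(1), of "j + l * k"] by (simp add: funpow_shift)
    finally show ?case using Suc by simp
  qed simp
  have "cyc (map v [0..<l]) i = v (i mod l)"
    using assms(2) by (simp add: cyc_def)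
  also have "\<dots> = v (i mod l + l * (i div l))" by (rule per[symmetric])
  finally show "cyc (map v [0..<l]) i = v i" by simp
qed

text \<open>If the first \<open>l\<close> letters were an \<open>m\<close>-fold repetition of
  \<open>y\<close> with \<open>m \<ge> 2\<close>, then \<open>length y\<close> would be a smaller
  positive period. Together with \<open>least_power_cyc\<close> this matches primitive words of
  length \<open>l\<close> with sequences of exact period \<open>l\<close>.\<close>

lemma not_power_least_power:
  assumes v: "(shift ^^ l) v = v" "l > 0" and l: "least_power shift v = l"
  shows "\<not> is_power (map v [0..<l])"
proof
  assume "is_power (map v [0..<l])"
  then obtain y m where m: "m \<ge> 2" "map v [0..<l] = concat (replicate m y)"
    unfolding is_power_def by blast
  define d where "d = length y"
  have len: "l = m * d"
    using arg_cong[OF m(2), of length] by (simp add: d_def length_concat sum_list_replicate)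
  then have d: "d > 0" using v(2) by (cases d) auto
  have val: "v j = y ! (j mod d)" for j
  proof -
    have "v j = map v [0..<l] ! (j mod l)"
      using fun_cong[OF cyc_map_upt[OF v], of j] by (simp add: cyc_def)
    also have "\<dots> = y ! (j mod l mod d)"
      unfolding m(2) d_def using v(2) len by (intro nth_concat_replicate) (simp add: d_def)
    also have "j mod l mod d = j mod d" unfolding len by (simp add: mod_mod_cancel)
    finally show ?thesis .
  qed
  have "(shift ^^ d) v = v"
    by (rule ext) (simp add: funpow_shift val)
  then have "l \<le> d" using least_power_le[OF _ d, of shift v] l by simp
  then show False using len m(1) d by simp
qed

lemma primitive_wordsD:
  assumes "w \<in> primitive_words I l"
  shows "set w \<subseteq> I" "length w = l" "l > 0" "least_power shift (cyc w) = l" "(shift ^^ l) (cyc w) = cyc w"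
proof -
  have w: "set w \<subseteq> I" "length w = l" "\<not> is_power w" using assms by (simp_all add: primitive_words_def)
  show "set w \<subseteq> I" "length w = l" by (fact w)+
  show "l > 0" using not_power_Nil[OF w(3)] w(2) by auto
  show "least_power shift (cyc w) = l" using least_power_cyc[OF w(3)] w(2) by simp
  show "(shift ^^ l) (cyc w) = cyc w" using cyc_periodic[of w] w(2) by simp
qed

lemma primitive_wordsI:
  "(shift ^^ l) v = v \<Longrightarrow> l > 0 \<Longrightarrow> least_power shift v = l \<Longrightarrow> range v \<subseteq> I \<Longrightarrow>
    map v [0..<l] \<in> primitive_words I l"
  using not_power_least_power[of l v] by (auto simp: primitive_words_def)

text \<open>On a periodic sequence a shift is undone by shifting on to a multiple of the period, so
  all sequences on one orbit have the same periods.\<close>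

lemma least_power_funpow_shift:
  assumes "(shift ^^ N) v = v" "N > 0"
  shows "least_power shift ((shift ^^ m) v) = least_power shift v"
proof -
  have "(shift ^^ d) ((shift ^^ m) v) = (shift ^^ m) v \<longleftrightarrow> (shift ^^ d) v = v" for d
  proof
    assume eq: "(shift ^^ d) ((shift ^^ m) v) = (shift ^^ m) v"
    have "(shift ^^ (N * m)) v = v"
      using least_power_shift[OF assms, of "N * m"] least_power_shift[OF assms, of N] assms by simp
    moreover have "N * m - m + m = N * m" using assms(2) by (cases N) auto
    ultimately have period: "(shift ^^ (N * m - m)) ((shift ^^ m) v) = v"
      by (metis comp_apply funpow_add)
    have "(shift ^^ d) v = (shift ^^ (N * m - m)) ((shift ^^ d) ((shift ^^ m) v))"
      by (subst period[symmetric]) (metis add.commute comp_apply funpow_add)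
    then show "(shift ^^ d) v = v" using eq period by simp
  next
    assume "(shift ^^ d) v = v"
    then show "(shift ^^ d) ((shift ^^ m) v) = (shift ^^ m) v"
      by (metis add.commute comp_apply funpow_add)
  qed
  then show ?thesis unfolding least_power_def by simp
qed

lemma rotate_primitive:
  assumes w: "w \<in> primitive_words I l"
  shows "rotate m w \<in> primitive_words I l"
proof -
  note wD = primitive_wordsD[OF w]
  define v where "v = cyc (rotate m w)"
  have v: "v = (shift ^^ m) (cyc w)"
    unfolding v_def using wD(2,3) by (intro cyc_rotate) auto
  have "map v [0..<l] = rotate m w"
    using map_cyc[of "rotate m w"] wD(2) by (simp add: v_def)
  moreover have "(shift ^^ l) v = v"
    using cyc_periodic[of "rotate m w"] wD(2) by (simp add: v_def)
  moreover have "least_power shift v = l"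
    unfolding v least_power_funpow_shift[OF wD(5,3)] by (rule wD(4))
  ultimately have "\<not> is_power (rotate m w)"
    using not_power_least_power[of l v] wD(3) by simp
  then show ?thesis using wD by (simp add: primitive_words_def)
qed

text \<open>Equal rotations by \<open>i < j\<close> would give the sequence the positive period
  \<open>j - i < l\<close>.\<close>

lemma inj_on_rotate_primitive:
  assumes w: "w \<in> primitive_words I l"
  shows "inj_on (\<lambda>m. rotate m w) {..<l}"
proof (rule linorder_inj_onI)
  fix i j assume ij: "i < j" "i \<in> {..<l}" "j \<in> {..<l}"
  note wD = primitive_wordsD[OF w]
  have ne: "w \<noteq> []" using wD by auto
  show "rotate i w \<noteq> rotate j w"
  proof
    assume "rotate i w = rotate j w"
    then have "(shift ^^ i) (cyc w) = (shift ^^ j) (cyc w)"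
      using cyc_rotate[OF ne, of i] cyc_rotate[OF ne, of j] by simp
    moreover have "(shift ^^ j) (cyc w) = (shift ^^ (j - i)) ((shift ^^ i) (cyc w))"
      using ij(1) fun_cong[OF funpow_add[of "j - i" i shift], of "cyc w"] by simp
    ultimately have "(shift ^^ (j - i)) ((shift ^^ i) (cyc w)) = (shift ^^ i) (cyc w)" by simp
    then have "least_power shift ((shift ^^ i) (cyc w)) dvd j - i"
      by (intro least_power_minimal) simp
    then have "l dvd j - i" by (simp add: least_power_funpow_shift[OF wD(5,3)] wD(4))
    then show False using ij by (auto dest: dvd_imp_le)
  qed
qed auto

text \<open>The \<open>l\<close> rotations of a primitive word are distinct, so
  \<open>card c\<close> is the common length of the words in \<open>c\<close>; sizes of multisets
  are expressed through it later.\<close>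

lemma primitive_classD:
  assumes c: "c \<in> primitive_classes I l" and w: "w \<in> c"
  shows "w \<in> primitive_words I l" "c = conjugacy `` {w}" "c = (\<lambda>m. rotate m w) ` {..<l}" "card c = l"
proof -
  obtain u where u: "u \<in> primitive_words I l" "c = conjugacy `` {u}"
    using c by (auto simp: primitive_classes_def quotient_def)
  then show prim: "w \<in> primitive_words I l"
    using w rotate_primitive by (auto simp: conjugacy_def)
  show c_eq: "c = conjugacy `` {w}"
    using u(2) w by (metis Image_singleton_iff equiv_class_eq equiv_conjugacy)
  have "rotate m w \<in> (\<lambda>m. rotate m w) ` {..<l}" for m
    using rotate_conv_mod[of m w] primitive_wordsD(2,3)[OF prim] by (auto intro!: image_eqI[of _ _ "m mod l"])
  then show "c = (\<lambda>m. rotate m w) ` {..<l}"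
    unfolding c_eq by (auto simp: conjugacy_def)
  then show "card c = l"
    using card_image[OF inj_on_rotate_primitive[OF prim]] by simp
qed

lemma primitive_class_nonempty: "c \<in> primitive_classes I l \<Longrightarrow> c \<noteq> {}"
  unfolding primitive_classes_def using equiv_class_self[OF equiv_conjugacy UNIV_I] by (metis empty_iff quotientE)

definition repr :: "'a list set \<Rightarrow> 'a list" where
  "repr c = (SOME w. w \<in> c)"

lemma repr_in: "c \<in> primitive_classes I l \<Longrightarrow> repr c \<in> c"
  unfolding repr_def using primitive_class_nonempty by (metis some_in_eq)

lemma class_of_primitive_word: "w \<in> primitive_words I l \<Longrightarrow> conjugacy `` {w} \<in> primitive_classes I l"
  unfolding primitive_classes_def by (rule quotientI)

lemma primitive_class_finite: "c \<in> primitive_classes I l \<Longrightarrow> finite c"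
  by (metis finite_imageI finite_lessThan primitive_classD(3) repr_in)

text \<open>The length is read off the sequence as its least period, and the word as an initial
  segment. Hence different classes share no sequence.\<close>

lemma cyc_eq_imp_eq:
  assumes "c \<in> primitive_classes I l" "c' \<in> primitive_classes I' l'" "w \<in> c" "w' \<in> c'" "cyc w = cyc w'"
  shows "w = w'" "c = c'"
proof -
  have "length w = length w'"
    using primitive_wordsD(2,4)[OF primitive_classD(1)[OF assms(1,3)]]
      primitive_wordsD(2,4)[OF primitive_classD(1)[OF assms(2,4)]] assms(5) by simp
  then have "map (cyc w) [0..<length w] = map (cyc w') [0..<length w']"
    unfolding assms(5) by simp
  then show "w = w'" unfolding map_cyc .
  then show "c = c'" using primitive_classD(2)[OF assms(1,3)] primitive_classD(2)[OF assms(2,4)] by simp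
qed

lemma cyc_image_inter:
  assumes "c \<in> primitive_classes I l" "c' \<in> primitive_classes I' l'" "v \<in> cyc ` c" "v \<in> cyc ` c'"
  shows "c = c'"
  using assms cyc_eq_imp_eq(2)[OF assms(1,2)] by blast

lemma inj_on_cyc: "c \<in> primitive_classes I l \<Longrightarrow> inj_on cyc c"
  by (rule inj_onI) (rule cyc_eq_imp_eq(1))

lemma cyc_class:
  assumes c: "c \<in> primitive_classes I l" and w: "w \<in> c"
  shows "cyc ` c = (\<lambda>m. (shift ^^ m) (cyc w)) ` {..<l}"
proof -
  have ne: "w \<noteq> []" using primitive_wordsD(2,3)[OF primitive_classD(1)[OF c w]] by auto
  have "cyc ` c = cyc ` (\<lambda>m. rotate m w) ` {..<l}"
    using arg_cong[OF primitive_classD(3)[OF c w], of "image cyc"] .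
  also have "\<dots> = (\<lambda>m. (shift ^^ m) (cyc w)) ` {..<l}"
    by (simp only: image_image cyc_rotate[OF ne])
  finally show ?thesis .
qed

lemma mset_cyc_class_shift_inv:
  assumes c: "c \<in> primitive_classes I l"
  shows "mset_set (cyc ` c) \<in> shift_inv_msets (card c)"
proof -
  have fin: "finite (cyc ` c)" using primitive_class_finite[OF c] by simp
  have sub: "shift ` cyc ` c \<subseteq> cyc ` c"
  proof clarify
    fix w assume w: "w \<in> c"
    note prim = primitive_classD(1)[OF c w]
    have "w \<noteq> []" using primitive_wordsD(2,3)[OF prim] by auto
    then have "shift (cyc w) = cyc (rotate 1 w)"
      using cyc_rotate[of w 1] by simp
    moreover have "(w, rotate 1 w) \<in> conjugacy" unfolding conjugacy_def by blast
    then have "rotate 1 w \<in> c" using primitive_classD(2)[OF c w] by simp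
    ultimately show "shift (cyc w) \<in> cyc ` c" by simp
  qed
  have inj: "inj_on shift (cyc ` c)"
  proof (rule inj_on_inverseI)
    fix v assume "v \<in> cyc ` c"
    then obtain w where w: "w \<in> c" "v = cyc w" by blast
    have "(shift ^^ Suc (l - 1)) v = v"
      using primitive_wordsD(3,5)[OF primitive_classD(1)[OF c w(1)]] w(2) by simp
    then show "(shift ^^ (l - 1)) (shift v) = v" by (simp only: funpow_Suc_right comp_apply)
  qed
  have "shift ` cyc ` c = cyc ` c" by (rule endo_inj_surj[OF fin sub inj])
  then have "image_mset shift (mset_set (cyc ` c)) = mset_set (cyc ` c)"
    by (simp add: image_mset_mset_set[OF inj])
  then show ?thesis
    using card_image[OF inj_on_cyc[OF c]] by (simp add: shift_inv_msets_def)
qed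

text \<open>The \<open>l\<close> sequences of the class start with the \<open>l\<close> letters of
  \<open>w\<close>, one sequence for each position in \<open>w\<close>.\<close>

lemma mset_weight_cyc_class:
  assumes c: "c \<in> primitive_classes I l" and w: "w \<in> c"
  shows "mset_weight p (mset_set (cyc ` c)) = word_weight p w"
proof -
  have inj: "inj_on (\<lambda>m. (shift ^^ m) (cyc w)) {..<l}"
  proof (rule eq_card_imp_inj_on)
    show "card ((\<lambda>m. (shift ^^ m) (cyc w)) ` {..<l}) = card {..<l}"
      unfolding cyc_class[OF c w, symmetric] card_image[OF inj_on_cyc[OF c]]
      using primitive_classD(4)[OF c w] by simp
  qed simp
  have "mset_weight p (mset_set (cyc ` c)) = (\<Prod>v\<in>cyc ` c. pmf p (v 0))"
    by (simp add: mset_weight_def prod_unfold_prod_mset)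
  also have "\<dots> = (\<Prod>m<l. pmf p (cyc w m))"
    unfolding cyc_class[OF c w] by (subst prod.reindex[OF inj]) (simp add: funpow_shift)
  also have "\<dots> = (\<Prod>m<l. pmf p (w ! m))"
    using primitive_wordsD(2)[OF primitive_classD(1)[OF c w]] by (intro prod.cong) (simp_all add: cyc_def)
  also have "\<dots> = word_weight p w"
    using primitive_wordsD(2)[OF primitive_classD(1)[OF c w]]
    by (simp add: word_weight_def prod.list_conv_set_nth atLeast0LessThan)
  finally show ?thesis .
qed

section \<open>Multiplicities of classes and containment of multisets\<close>

definition class_mult :: "(nat \<Rightarrow> 'a) multiset \<Rightarrow> 'a list set \<Rightarrow> nat" where
  "class_mult M c = count M (cyc (repr c))"

lemma count_shift_inv:
  assumes M: "M \<in> shift_inv_msets n"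
  shows "count M v \<le> count M (shift v)"
proof -
  have M_eq: "image_mset shift M = M" using M by (simp add: shift_inv_msets_def)
  have "count M v = (\<Sum>u\<in>{v} \<inter> set_mset M. count M u)"
    by (cases "v \<in># M") (auto simp: not_in_iff)
  also have "\<dots> \<le> (\<Sum>u\<in>shift -` {shift v} \<inter> set_mset M. count M u)"
    by (rule sum_mono2) auto
  also have "\<dots> = count M (shift v)"
    by (subst (3) M_eq[symmetric]) (simp add: count_image_mset)
  finally show ?thesis .
qed

text \<open>Counts can only grow along \<open>shift\<close>, and within a class every sequence is a
  shift of every other, so they are constant. Thus \<open>class_mult\<close> does not depend on the
  word chosen by \<open>repr\<close>.\<close>

lemma count_cyc_class:
  assumes c: "c \<in> primitive_classes I l" and M: "M \<in> shift_inv_msets n" and v: "v \<in> cyc ` c"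
  shows "count M v = class_mult M c"
proof -
  have le: "count M u \<le> count M ((shift ^^ m) u)" for u m
    by (induction m) (auto intro: le_trans[OF _ count_shift_inv[OF M]])
  have "count M (cyc w) \<le> count M (cyc w')" if "w \<in> c" "w' \<in> c" for w w'
    using cyc_class[OF c that(1)] that(2) le[of "cyc w"] by (metis (no_types, lifting) image_iff)
  then show ?thesis
    using v repr_in[OF c] unfolding class_mult_def by (metis (no_types, lifting) image_iff le_antisym)
qed

definition classes_mset :: "'a list set set \<Rightarrow> ('a list set \<Rightarrow> nat) \<Rightarrow> (nat \<Rightarrow> 'a) multiset" where
  "classes_mset F \<mu> = (\<Sum>c\<in>F. repeat_mset (\<mu> c) (mset_set (cyc ` c)))"

lemma image_mset_repeat_mset: "image_mset f (repeat_mset k M) = repeat_mset k (image_mset f M)"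
  by (induction k) simp_all

lemma shift_inv_msets_repeat:
  "M \<in> shift_inv_msets m \<Longrightarrow> repeat_mset k M \<in> shift_inv_msets (k * m)"
  by (simp add: shift_inv_msets_def image_mset_repeat_mset)

lemma classes_mset_shift_inv:
  "finite F \<Longrightarrow> F \<subseteq> (\<Union>l. primitive_classes I l) \<Longrightarrow>
    classes_mset F \<mu> \<in> shift_inv_msets (\<Sum>c\<in>F. \<mu> c * card c)"
proof (induction F rule: finite_induct)
  case (insert c F)
  then show ?case
    using shift_inv_msets_add[OF shift_inv_msets_repeat[OF mset_cyc_class_shift_inv]]
    by (auto simp: classes_mset_def)
qed (simp add: classes_mset_def shift_inv_msets_def)

lemma mset_weight_classes_mset:
  assumes "finite F" "F \<subseteq> (\<Union>l. primitive_classes I l)"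
  shows "mset_weight p (classes_mset F \<mu>) = (\<Prod>c\<in>F. word_weight p (repr c) ^ \<mu> c)"
  using assms
proof (induction F rule: finite_induct)
  case (insert c F)
  have "mset_weight p (repeat_mset k M) = mset_weight p M ^ k" for k and M :: "(nat \<Rightarrow> 'a) multiset"
    by (simp add: mset_weight_def image_mset_repeat_mset) (induction k, simp_all)
  moreover obtain l where "c \<in> primitive_classes I l" using insert.prems by blast
  then have "mset_weight p (mset_set (cyc ` c)) = word_weight p (repr c)"
    by (intro mset_weight_cyc_class repr_in)
  ultimately show ?case
    using insert by (simp add: classes_mset_def mset_weight_union)
qed (simp add: classes_mset_def mset_weight_def)

text \<open>Since different classes share no sequence, a sequence of \<open>c\<close> occurs exactly
  \<open>\<mu> c\<close> times on the left, and by invariance \<open>class_mult M c\<close> times on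
  the right.\<close>

lemma classes_mset_subset_iff:
  assumes "finite F" "F \<subseteq> (\<Union>l. primitive_classes I l)" "M \<in> shift_inv_msets n"
  shows "classes_mset F \<mu> \<subseteq># M \<longleftrightarrow> (\<forall>c\<in>F. \<mu> c \<le> class_mult M c)"
proof -
  have fin: "finite (cyc ` c)" if "c \<in> F" for c
    using that assms(2) primitive_class_finite by blast
  have count_K: "count (classes_mset F \<mu>) v = (\<Sum>c\<in>F. if v \<in> cyc ` c then \<mu> c else 0)" for v
    unfolding classes_mset_def count_sum by (intro sum.cong) (simp_all add: count_mset_set' fin)
  have count_c: "count (classes_mset F \<mu>) v = \<mu> c" if "c \<in> F" "v \<in> cyc ` c" for v c
  proof -
    have iff: "v \<in> cyc ` c' \<longleftrightarrow> c' = c" if c': "c' \<in> F" for c'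
    proof -
      obtain l where "c \<in> primitive_classes I l" using \<open>c \<in> F\<close> assms(2) by blast
      moreover obtain l' where "c' \<in> primitive_classes I l'" using c' assms(2) by blast
      ultimately show ?thesis using cyc_image_inter \<open>v \<in> cyc ` c\<close> by metis
    qed
    have "(\<Sum>c'\<in>F. if v \<in> cyc ` c' then \<mu> c' else 0) = (\<Sum>c'\<in>F. if c' = c then \<mu> c' else 0)"
      by (rule sum.cong) (simp_all only: iff)
    then show ?thesis unfolding count_K using that(1) assms(1) by simp
  qed
  show ?thesis
  proof
    assume sub: "classes_mset F \<mu> \<subseteq># M"
    show "\<forall>c\<in>F. \<mu> c \<le> class_mult M c"
    proof
      fix c assume c: "c \<in> F"
      then obtain l where "c \<in> primitive_classes I l" using assms(2) by blast
      then show "\<mu> c \<le> class_mult M c"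
        using count_c[OF c, of "cyc (repr c)"] repr_in sub
        by (metis class_mult_def image_eqI mset_subset_eq_count)
    qed
  next
    assume le: "\<forall>c\<in>F. \<mu> c \<le> class_mult M c"
    show "classes_mset F \<mu> \<subseteq># M"
    proof (rule mset_subset_eqI)
      fix v show "count (classes_mset F \<mu>) v \<le> count M v"
      proof (cases "\<exists>c\<in>F. v \<in> cyc ` c")
        case True
        then obtain c where c: "c \<in> F" "v \<in> cyc ` c" by blast
        then obtain l where "c \<in> primitive_classes I l" using assms(2) by blast
        then show ?thesis using count_c[OF c] count_cyc_class[OF _ assms(3) c(2)] le c(1) by simp
      next
        case False
        then show ?thesis unfolding count_K by (subst sum.neutral) auto
      qed
    qed
  qed
qed

text \<open>The threshold is the size of \<open>classes_mset F \<mu>\<close>: a shorter word cannot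
  hold these copies. From there on the probability is free of \<open>n\<close> and factors over the
  classes.\<close>

lemma prob_class_mult_ge:
  fixes p :: "real pmf"
  assumes "finite F" "F \<subseteq> (\<Union>l. primitive_classes I l)"
  shows "measure_pmf.prob (iid_words n p) {g. \<forall>c\<in>F. \<mu> c \<le> class_mult (past_mset n g) c} =
    (if (\<Sum>c\<in>F. \<mu> c * card c) \<le> n then \<Prod>c\<in>F. word_weight p (repr c) ^ \<mu> c else 0)"
  using prob_submset_past_mset[OF classes_mset_shift_inv[OF assms], of n p \<mu>]
  unfolding classes_mset_subset_iff[OF assms past_mset_shift_inv] mset_weight_classes_mset[OF assms] .

section \<open>From multiplicities to cycle counts\<close>

lemma least_power_past:
  assumes "x \<in> {1..n}"
  shows "least_power shift (past n g x) = card (orbit (std_perm n g) x)"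
proof -
  define \<tau> where "\<tau> = inv (std_perm n g)"
  have perm: "permutation (std_perm n g)" using std_perm_permutes unfolding permutation_permutes by blast
  have perm_inv: "permutation \<tau>" unfolding \<tau>_def by (rule permutation_inverse[OF perm])
  define d where "d = least_power \<tau> x"
  have d: "(\<tau> ^^ d) x = x" "d > 0" unfolding d_def by (rule least_power_of_permutation[OF perm_inv])+
  \<comment> \<open>\<open>shift\<close> takes the sequence at \<open>x\<close> to the one at
    \<open>\<tau> x\<close>, and by \<open>past_injective\<close> the sequences along a cycle repeat
    no sooner than the positions do.\<close>
  have "(shift ^^ m) (past n g x) = past n g x \<longleftrightarrow> (\<tau> ^^ m) x = x" for m
    using past_injective[OF assms funpow_inv_std_perm_in[OF assms], where g = g and d = m, OF _ refl]
    unfolding funpow_shift_past \<tau>_def by metis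
  then have "least_power shift (past n g x) = d"
    unfolding d_def least_power_def by simp
  also have "d = card ((\<lambda>i. (\<tau> ^^ i) x) ` {..<d})"
  proof (subst card_image)
    show "inj_on (\<lambda>i. (\<tau> ^^ i) x) {..<d}"
    proof (rule linorder_inj_onI)
      fix i j assume ij: "i < j" "i \<in> {..<d}" "j \<in> {..<d}"
      show "(\<tau> ^^ i) x \<noteq> (\<tau> ^^ j) x"
      proof
        assume "(\<tau> ^^ i) x = (\<tau> ^^ j) x"
        then have "(\<tau> ^^ i) x = (\<tau> ^^ i) ((\<tau> ^^ (j - i)) x)"
          using ij(1) by (metis comp_apply funpow_add le_add_diff_inverse less_imp_le)
        then have "(\<tau> ^^ (j - i)) x = x"
          using inj_fn[OF bij_is_inj[OF permutation_bijective[OF perm_inv]], of i] by (metis injD)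
        then have "d \<le> j - i" unfolding d_def using ij(1) by (intro least_power_le) auto
        then show False using ij by simp
      qed
    qed auto
  qed simp
  also have "(\<lambda>i. (\<tau> ^^ i) x) ` {..<d} = orbit \<tau> x"
    using orbit_altdef_bounded[OF d] by auto
  also have "\<dots> = orbit (std_perm n g) x"
    unfolding \<tau>_def by (rule orbit_inv_eq[OF perm])
  finally show ?thesis .
qed

lemma card_union_orbits:
  assumes "\<sigma> permutes A" "finite A"
  shows "card {x \<in> A. card (orbit \<sigma> x) = l} = l * card {C \<in> orbit \<sigma> ` A. card C = l}"
proof -
  have perm: "permutation \<sigma>" using assms unfolding permutation_permutes by blast
  have self: "x \<in> orbit \<sigma> x" for x by (rule permutation_self_in_orbit[OF perm])
  have eq: "orbit \<sigma> y = orbit \<sigma> x" if "y \<in> orbit \<sigma> x" for x y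
    using orbit_cyclic_eq3[OF cyclic_on_orbit'[OF perm] that] .
  have union: "{x \<in> A. card (orbit \<sigma> x) = l} = \<Union>{C \<in> orbit \<sigma> ` A. card C = l}"
    using self eq permutes_orbit_subset[OF assms(1)] by auto blast+
  have "card (\<Union>{C \<in> orbit \<sigma> ` A. card C = l}) = (\<Sum>C | C \<in> orbit \<sigma> ` A \<and> card C = l. card C)"
  proof (rule card_Union_disjoint)
    show "pairwise disjnt {C \<in> orbit \<sigma> ` A. card C = l}"
      using eq by (auto simp: pairwise_def disjnt_def) blast+
    show "finite C" if "C \<in> {C \<in> orbit \<sigma> ` A. card C = l}" for C
      using that permutes_orbit_subset[OF assms(1)] finite_subset[OF _ assms(2)] by blast
  qed
  then show ?thesis unfolding union by (simp add: mult.commute)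
qed

text \<open>The positions whose sequence has exact period \<open>l\<close> are counted twice: each
  cycle of length \<open>l\<close> carries \<open>l\<close> of them, and each class consists of
  \<open>l\<close> sequences found at \<open>class_mult\<close> positions each. \<open>F\<close>
  contains all classes that occur, which keeps the sum finite over an infinite alphabet.\<close>

lemma num_cycles_eq_sum_class_mult:
  assumes g: "g ` {1..n} \<subseteq> I" and F: "finite F" "F \<subseteq> primitive_classes I l" and l: "l > 0"
    and zero: "\<And>c. c \<in> primitive_classes I l - F \<Longrightarrow> class_mult (past_mset n g) c = 0"
  shows "num_cycles n (std_perm n g) l = (\<Sum>c\<in>F. class_mult (past_mset n g) c)"
proof -
  define S where "S = {x \<in> {1..n}. least_power shift (past n g x) = l}"
  define M where "M = past_mset n g"
  have M: "M \<in> shift_inv_msets n" unfolding M_def by (rule past_mset_shift_inv)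
  have count_M: "count M v = card {x \<in> {1..n}. past n g x = v}" for v
    unfolding M_def past_mset_def by (rule count_image_mset_set) simp
  have "l * num_cycles n (std_perm n g) l = card {x \<in> {1..n}. card (orbit (std_perm n g) x) = l}"
    unfolding num_cycles_def card_union_orbits[OF std_perm_permutes finite_atLeastAtMost] ..
  also have "{x \<in> {1..n}. card (orbit (std_perm n g) x) = l} = S"
    unfolding S_def using least_power_past by auto
  also have "S = (\<Union>c\<in>F. {x \<in> {1..n}. past n g x \<in> cyc ` c})"
  proof (intro equalityI subsetI)
    fix x assume x: "x \<in> S"
    define v where "v = past n g x"
    have "permutation (inv (std_perm n g))"
      using inv_std_perm_permutes unfolding permutation_permutes by blast
    then obtain N where "(inv (std_perm n g) ^^ N) x = x" "N > 0"
      using least_power_of_permutation by metis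
    then have "(shift ^^ N) v = v" "N > 0" by (simp_all add: v_def funpow_shift_past)
    from least_powerI[OF this] have v: "(shift ^^ l) v = v" "least_power shift v = l"
      using x by (simp_all add: S_def v_def)
    have "range v \<subseteq> I"
      using g funpow_inv_std_perm_in[of x n _ g] x unfolding v_def past_def S_def by blast
    with v l have w: "map v [0..<l] \<in> primitive_words I l" by (intro primitive_wordsI)
    define c where "c = conjugacy `` {map v [0..<l]}"
    have c: "c \<in> primitive_classes I l" unfolding c_def by (rule class_of_primitive_word[OF w])
    have "map v [0..<l] \<in> c"
      unfolding c_def using equiv_class_self[OF equiv_conjugacy] by blast
    then have v_in: "v \<in> cyc ` c" using cyc_map_upt[OF v(1) l] by (metis image_eqI)
    \<comment> \<open>The sequence \<open>v\<close> occurs at \<open>x\<close> itself, so its class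
      has positive multiplicity and must belong to \<open>F\<close>.\<close>
    have "x \<in> {x \<in> {1..n}. past n g x = v}" using x by (simp add: v_def S_def)
    then have "count M v > 0" unfolding count_M by (subst card_gt_0_iff) auto
    then have "class_mult M c \<noteq> 0" using count_cyc_class[OF c M v_in] by simp
    then have "c \<in> F" using zero[of c] c by (cases "c \<in> F") (simp_all add: M_def)
    then show "x \<in> (\<Union>c\<in>F. {x \<in> {1..n}. past n g x \<in> cyc ` c})"
      using x v_in by (auto simp: S_def v_def)
  next
    fix x assume "x \<in> (\<Union>c\<in>F. {x \<in> {1..n}. past n g x \<in> cyc ` c})"
    then obtain c w where c: "c \<in> F" "w \<in> c" "past n g x = cyc w" "x \<in> {1..n}" by blast
    then show "x \<in> S"
      using primitive_wordsD(4)[OF primitive_classD(1)] F(2) unfolding S_def by fastforce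
  qed
  also have "card (\<Union>c\<in>F. {x \<in> {1..n}. past n g x \<in> cyc ` c}) = (\<Sum>c\<in>F. card {x \<in> {1..n}. past n g x \<in> cyc ` c})"
  proof (rule card_UN_disjoint)
    have "c = c'" if "c \<in> F" "c' \<in> F" "past n g x \<in> cyc ` c" "past n g x \<in> cyc ` c'" for c c' x
      using cyc_image_inter[of c I l c' I l "past n g x"] that F(2) by blast
    then show "\<forall>c\<in>F. \<forall>c'\<in>F. c \<noteq> c' \<longrightarrow>
        {x \<in> {1..n}. past n g x \<in> cyc ` c} \<inter> {x \<in> {1..n}. past n g x \<in> cyc ` c'} = {}"
      by (intro ballI impI equals0I) blast
  qed (use F in auto)
  also have "\<dots> = (\<Sum>c\<in>F. l * class_mult M c)"
  proof (rule sum.cong[OF refl])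
    fix c assume "c \<in> F"
    then have c: "c \<in> primitive_classes I l" using F(2) by blast
    have "{x \<in> {1..n}. past n g x \<in> cyc ` c} = (\<Union>v\<in>cyc ` c. {x \<in> {1..n}. past n g x = v})" by auto
    also have "card \<dots> = (\<Sum>v\<in>cyc ` c. card {x \<in> {1..n}. past n g x = v})"
      by (rule card_UN_disjoint) (use primitive_class_finite[OF c] in auto)
    also have "\<dots> = (\<Sum>v\<in>cyc ` c. class_mult M c)"
      using count_cyc_class[OF c M] by (simp add: count_M)
    also have "\<dots> = l * class_mult M c"
      using card_image[OF inj_on_cyc[OF c]] primitive_classD(4)[OF c repr_in[OF c]] by simp
    finally show "card {x \<in> {1..n}. past n g x \<in> cyc ` c} = l * class_mult M c" .
  qed
  finally have "l * num_cycles n (std_perm n g) l = l * (\<Sum>c\<in>F. class_mult M c)"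
    by (simp add: sum_distrib_left)
  then show ?thesis using l by (simp add: M_def)
qed

section \<open>Truncation of families of natural random variables\<close>

text \<open>Both sides are 0 by convention when \<open>f\<close> is not summable, so measurability
  of parameter integrals transfers to \<open>infsum\<close> even at points where the sum
  diverges.\<close>

lemma infsum_eq_integral_count_space:
  fixes f :: "'a \<Rightarrow> real"
  shows "infsum f A = (\<integral>x. f x \<partial>count_space A)"
proof (cases "f summable_on A")
  case True
  then have "Infinite_Set_Sum.abs_summable_on f A"
    using summable_on_iff_abs_summable_on_real abs_summable_equivalent by blast
  then show ?thesis using infsetsum_infsum[of f A] by (simp add: infsetsum_def)
next
  case False
  then have "\<not> integrable (count_space A) f"
    using summable_on_iff_abs_summable_on_real abs_summable_equivalent unfolding abs_summable_on_def by blast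
  then show ?thesis using False by (simp add: infsum_not_exists not_integrable_integral_eq)
qed

lemma borel_measurable_infsum:
  fixes f :: "'a \<Rightarrow> 'b \<Rightarrow> real"
  assumes C: "countable C" and f: "\<And>c. c \<in> C \<Longrightarrow> f c \<in> borel_measurable M"
  shows "(\<lambda>\<omega>. \<Sum>\<^sub>\<infinity>c\<in>C. f c \<omega>) \<in> borel_measurable M"
proof -
  interpret sigma_finite_measure "count_space C" by (rule sigma_finite_measure_count_space_countable[OF C])
  have "(\<lambda>x. f (snd x) (fst x)) \<in> borel_measurable (M \<Otimes>\<^sub>M count_space C)"
    by (rule measurable_compose_countable'[where f = "\<lambda>c x. f c (fst x)" and I = C])
      (use f C in auto)
  then have "(\<lambda>\<omega>. \<integral>c. f c \<omega> \<partial>count_space C) \<in> borel_measurable M"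
    by (intro borel_measurable_lebesgue_integral) (simp add: case_prod_beta')
  then show ?thesis unfolding infsum_eq_integral_count_space .
qed

lemma nn_integral_count_space_eq_infsum:
  fixes b :: "'a \<Rightarrow> real"
  assumes "b summable_on C" "\<And>c. c \<in> C \<Longrightarrow> b c \<ge> 0"
  shows "(\<integral>\<^sup>+c. b c \<partial>count_space C) = ennreal (\<Sum>\<^sub>\<infinity>c\<in>C. b c)"
proof -
  have "Infinite_Set_Sum.abs_summable_on b C"
    using assms(1) summable_on_iff_abs_summable_on_real abs_summable_equivalent by blast
  then show ?thesis
    using nn_integral_conv_infsetsum[of b C] infsetsum_infsum[of b C] assms(2) by simp
qed

text \<open>The number \<open>D \<omega>\<close> of events that occur at \<open>\<omega>\<close> has
  integral at most the sum of the \<open>b c\<close>. It dominates the indicator of the union and is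
  finite almost everywhere, which gives the two claims.\<close>

lemma (in finite_measure) union_bound_and_Borel_Cantelli:
  assumes C: "countable C" and A: "\<And>c. c \<in> C \<Longrightarrow> A c \<in> sets M"
    and b: "b summable_on C" "\<And>c. c \<in> C \<Longrightarrow> measure M (A c) \<le> b c"
  shows "measure M (\<Union>c\<in>C. A c) \<le> (\<Sum>\<^sub>\<infinity>c\<in>C. b c)" "AE \<omega> in M. finite {c \<in> C. \<omega> \<in> A c}"
proof -
  define D where "D \<omega> = (\<integral>\<^sup>+c. indicator (A c) \<omega> \<partial>count_space C)" for \<omega>
  have b_nonneg: "b c \<ge> 0" if "c \<in> C" for c using b(2)[OF that] measure_nonneg order_trans by blast
  have D_measurable: "D \<in> borel_measurable M"
  proof -
    interpret sigma_finite_measure "count_space C" by (rule sigma_finite_measure_count_space_countable[OF C])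
    have "(\<lambda>x. indicator (A (snd x)) (fst x) :: ennreal) \<in> borel_measurable (M \<Otimes>\<^sub>M count_space C)"
      by (rule measurable_compose_countable'[where f = "\<lambda>c x. indicator (A c) (fst x)" and I = C])
        (use A C in auto)
    then show ?thesis
      unfolding D_def by (intro borel_measurable_nn_integral) (simp add: case_prod_beta')
  qed
  have "(\<integral>\<^sup>+\<omega>. D \<omega> \<partial>M) = (\<integral>\<^sup>+c. emeasure M (A c) \<partial>count_space C)"
    unfolding D_def
    by (subst nn_integral_count_space_nn_integral[OF C]) (use A in \<open>auto intro!: nn_integral_cong\<close>)
  also have "\<dots> \<le> (\<integral>\<^sup>+c. b c \<partial>count_space C)"
    by (intro nn_integral_mono) (use b b_nonneg in \<open>simp add: emeasure_eq_measure\<close>)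
  also have "\<dots> = ennreal (\<Sum>\<^sub>\<infinity>c\<in>C. b c)"
    by (rule nn_integral_count_space_eq_infsum[OF b(1) b_nonneg])
  finally have D_le: "(\<integral>\<^sup>+\<omega>. D \<omega> \<partial>M) \<le> ennreal (\<Sum>\<^sub>\<infinity>c\<in>C. b c)" .
  have single: "indicator (A c) \<omega> \<le> D \<omega>" if "c \<in> C" for c \<omega>
  proof -
    have "indicator (A c) \<omega> = (\<integral>\<^sup>+c'. indicator (A c) \<omega> * indicator {c} c' \<partial>count_space C)"
      using that by (subst nn_integral_cmult_indicator) auto
    also have "\<dots> \<le> D \<omega>" unfolding D_def
      by (intro nn_integral_mono) (auto simp: indicator_def)
    finally show ?thesis .
  qed
  have union: "(\<Union>c\<in>C. A c) \<in> sets M" using A by (intro sets.countable_UN' C) auto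
  have "emeasure M (\<Union>c\<in>C. A c) = (\<integral>\<^sup>+\<omega>. indicator (\<Union>c\<in>C. A c) \<omega> \<partial>M)"
    using union by simp
  also have "\<dots> \<le> (\<integral>\<^sup>+\<omega>. D \<omega> \<partial>M)"
  proof (rule nn_integral_mono)
    fix \<omega>
    show "indicator (\<Union>c\<in>C. A c) \<omega> \<le> D \<omega>"
    proof (cases "\<omega> \<in> (\<Union>c\<in>C. A c)")
      case True
      then obtain c where "c \<in> C" "\<omega> \<in> A c" by blast
      then show ?thesis using True single[of c \<omega>] by simp
    qed simp
  qed
  also note D_le
  finally show "measure M (\<Union>c\<in>C. A c) \<le> (\<Sum>\<^sub>\<infinity>c\<in>C. b c)"
    using b_nonneg by (simp add: emeasure_eq_measure infsum_nonneg)
  have "AE \<omega> in M. D \<omega> \<noteq> \<infinity>"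
    by (rule nn_integral_PInf_AE[OF D_measurable]) (use D_le in \<open>auto simp: top_unique\<close>)
  then show "AE \<omega> in M. finite {c \<in> C. \<omega> \<in> A c}"
  proof eventually_elim
    case (elim \<omega>)
    have "D \<omega> = (\<integral>\<^sup>+c. indicator {c \<in> C. \<omega> \<in> A c} c \<partial>count_space C)"
      unfolding D_def by (intro nn_integral_cong) (auto simp: indicator_def)
    also have "\<dots> = emeasure (count_space C) {c \<in> C. \<omega> \<in> A c}"
      by (rule nn_integral_indicator) auto
    finally show ?case using elim by (cases "finite {c \<in> C. \<omega> \<in> A c}") auto
  qed
qed

text \<open>Coordinate by coordinate, \<open>P(Z = \<mu>) = P(Z \<ge> \<mu>) - P(Z \<ge> \<mu> + 1)\<close>.\<close>

lemma prob_eq_of_prob_ge: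
  fixes Z :: "'c \<Rightarrow> 'a \<Rightarrow> nat" and Z' :: "'c \<Rightarrow> 'b \<Rightarrow> nat"
  assumes "finite_measure P" "finite_measure Q" and F: "finite F"
    and Z: "\<And>c. c \<in> F \<Longrightarrow> Z c \<in> measurable P (count_space UNIV)"
    and Z': "\<And>c. c \<in> F \<Longrightarrow> Z' c \<in> measurable Q (count_space UNIV)"
    and ge: "\<And>\<nu>. \<forall>c\<in>F. \<nu> c \<le> Suc (\<mu> c) \<Longrightarrow> measure P {\<omega>\<in>space P. \<forall>c\<in>F. \<nu> c \<le> Z c \<omega>} =
      measure Q {\<omega>\<in>space Q. \<forall>c\<in>F. \<nu> c \<le> Z' c \<omega>}"
  shows "measure P {\<omega>\<in>space P. \<forall>c\<in>F. Z c \<omega> = \<mu> c} = measure Q {\<omega>\<in>space Q. \<forall>c\<in>F. Z' c \<omega> = \<mu> c}"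
proof -
  interpret P: finite_measure P by fact
  interpret Q: finite_measure Q by fact
  \<comment> \<open>\<open>S A \<nu>\<close> interpolates between the two kinds of events: exact
    values on \<open>A\<close>, lower bounds on \<open>F - A\<close>. Moving \<open>a\<close> into
    \<open>A\<close> uses the thresholds \<open>\<mu> a\<close> and \<open>Suc (\<mu> a)\<close>, so
    all thresholds stay below a bound given by \<open>\<mu>\<close>, and one \<open>n\<close> can
    serve a whole box.\<close>
  define S where "S A \<nu> = {\<omega>\<in>space P. (\<forall>c\<in>A. Z c \<omega> = \<mu> c) \<and> (\<forall>c\<in>F - A. \<nu> c \<le> Z c \<omega>)}" for A \<nu>
  define S' where "S' A \<nu> = {\<omega>\<in>space Q. (\<forall>c\<in>A. Z' c \<omega> = \<mu> c) \<and> (\<forall>c\<in>F - A. \<nu> c \<le> Z' c \<omega>)}" for A \<nu>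
  have S_sets: "S A \<nu> \<in> sets P" if "A \<subseteq> F" for A \<nu>
  proof -
    have "finite A" "finite (F - A)" using F finite_subset[OF that] by auto
    moreover have "Z c \<in> measurable P (count_space UNIV)" if "c \<in> A" for c using Z \<open>A \<subseteq> F\<close> that by blast
    moreover have "Z c \<in> measurable P (count_space UNIV)" if "c \<in> F - A" for c using Z that by blast
    ultimately show ?thesis unfolding S_def by measurable
  qed
  have S'_sets: "S' A \<nu> \<in> sets Q" if "A \<subseteq> F" for A \<nu>
  proof -
    have "finite A" "finite (F - A)" using F finite_subset[OF that] by auto
    moreover have "Z' c \<in> measurable Q (count_space UNIV)" if "c \<in> A" for c using Z' \<open>A \<subseteq> F\<close> that by blast
    moreover have "Z' c \<in> measurable Q (count_space UNIV)" if "c \<in> F - A" for c using Z' that by blast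
    ultimately show ?thesis unfolding S'_def by measurable
  qed
  have "measure P (S A \<nu>) = measure Q (S' A \<nu>)"
    if "finite A" "A \<subseteq> F" "\<forall>c\<in>F. \<nu> c \<le> Suc (\<mu> c)" for A \<nu>
    using that
  proof (induction A arbitrary: \<nu> rule: finite_induct)
    case empty
    then show ?case using ge by (simp add: S_def S'_def)
  next
    case (insert a A)
    have a: "a \<in> F" "A \<subseteq> F" "a \<notin> A" using insert by auto
    have "S (insert a A) \<nu> = S A (\<nu>(a := \<mu> a)) - S A (\<nu>(a := Suc (\<mu> a)))"
      using a unfolding S_def by (auto simp: not_less_eq_eq le_antisym split: if_splits)
    moreover have "S A (\<nu>(a := Suc (\<mu> a))) \<subseteq> S A (\<nu>(a := \<mu> a))"
      using a unfolding S_def by (force split: if_splits)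
    ultimately have P_diff: "measure P (S (insert a A) \<nu>) =
        measure P (S A (\<nu>(a := \<mu> a))) - measure P (S A (\<nu>(a := Suc (\<mu> a))))"
      using P.finite_measure_Diff[OF S_sets S_sets] a(2) by simp
    have "S' (insert a A) \<nu> = S' A (\<nu>(a := \<mu> a)) - S' A (\<nu>(a := Suc (\<mu> a)))"
      using a unfolding S'_def by (auto simp: not_less_eq_eq le_antisym split: if_splits)
    moreover have "S' A (\<nu>(a := Suc (\<mu> a))) \<subseteq> S' A (\<nu>(a := \<mu> a))"
      using a unfolding S'_def by (force split: if_splits)
    ultimately have Q_diff: "measure Q (S' (insert a A) \<nu>) =
        measure Q (S' A (\<nu>(a := \<mu> a))) - measure Q (S' A (\<nu>(a := Suc (\<mu> a))))"
      using Q.finite_measure_Diff[OF S'_sets S'_sets] a(2) by simp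
    show ?case unfolding P_diff Q_diff using insert.IH insert.prems by simp
  qed
  from this[OF F subset_refl, of \<mu>] show ?thesis by (simp add: S_def S'_def)
qed

text \<open>Used for the limit and for the random word with the same \<open>\<phi>\<close>, so that
  both expectations are compared with finite sums agreeing term by term. Off the bad event
  \<open>h\<close> equals the step function \<open>s\<close>; on it both are at most
  \<open>B\<close> in absolute value, whence the factor \<open>2 * B\<close>.\<close>

lemma (in prob_space) expectation_approx_by_box:
  fixes Z :: "'c \<Rightarrow> 'a \<Rightarrow> nat" and h :: "'a \<Rightarrow> real"
  assumes F: "finite F" "F \<subseteq> T" and T: "countable T"
    and Z: "\<And>c. c \<in> T \<Longrightarrow> Z c \<in> measurable M (count_space UNIV)"
    and h: "h \<in> borel_measurable M" "\<And>\<omega>. \<bar>h \<omega>\<bar> \<le> B" and \<phi>: "\<And>\<mu>. \<bar>\<phi> \<mu>\<bar> \<le> B"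
    and h_eq: "AE \<omega> in M. (\<forall>c\<in>T - F. Z c \<omega> = 0) \<longrightarrow> h \<omega> = \<phi> (\<lambda>c\<in>F. Z c \<omega>)"
    and tail: "prob {\<omega>\<in>space M. (\<exists>c\<in>T - F. Z c \<omega> \<noteq> 0) \<or> (\<exists>c\<in>F. L < Z c \<omega>)} \<le> \<epsilon>"
  shows "\<bar>expectation h - (\<Sum>\<mu>\<in>F \<rightarrow>\<^sub>E {..L}. \<phi> \<mu> * prob {\<omega>\<in>space M. \<forall>c\<in>F. Z c \<omega> = \<mu> c})\<bar> \<le> 2 * B * \<epsilon>"
proof -
  define E where "E \<mu> = {\<omega>\<in>space M. \<forall>c\<in>F. Z c \<omega> = \<mu> c}" for \<mu>
  define bad where "bad = {\<omega>\<in>space M. (\<exists>c\<in>T - F. Z c \<omega> \<noteq> 0) \<or> (\<exists>c\<in>F. L < Z c \<omega>)}"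
  define box where "box = F \<rightarrow>\<^sub>E {..L}"
  define s where "s \<omega> = (\<Sum>\<mu>\<in>box. \<phi> \<mu> * indicator (E \<mu>) \<omega>)" for \<omega>
  have B: "B \<ge> 0" using \<phi>[of undefined] by linarith
  have fin: "finite box" unfolding box_def using F(1) by (intro finite_PiE) auto
  have Z_F: "Z c \<in> measurable M (count_space UNIV)" if "c \<in> F" for c using Z F(2) that by blast
  have E_sets: "E \<mu> \<in> sets M" for \<mu>
    unfolding E_def using Z_F F(1) by measurable
  have bad_sets: "bad \<in> sets M"
  proof -
    have "bad = (\<Union>c\<in>T - F. Z c -` {0<..} \<inter> space M) \<union> (\<Union>c\<in>F. Z c -` {L<..} \<inter> space M)"
      unfolding bad_def by auto
    also have "\<dots> \<in> sets M"
      using Z Z_F T F(1) by (intro sets.Un sets.countable_UN' sets.finite_UN measurable_sets) auto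
    finally show ?thesis .
  qed
  have s_eq: "s \<omega> = (if \<forall>c\<in>F. Z c \<omega> \<le> L then \<phi> (\<lambda>c\<in>F. Z c \<omega>) else 0)" if "\<omega> \<in> space M" for \<omega>
  proof -
    have ind: "indicator (E \<mu>) \<omega> = (if \<mu> = (\<lambda>c\<in>F. Z c \<omega>) then 1 else 0 :: real)" if "\<mu> \<in> box" for \<mu>
    proof -
      have "\<mu> = (\<lambda>c\<in>F. Z c \<omega>) \<longleftrightarrow> (\<forall>c\<in>F. Z c \<omega> = \<mu> c)"
        using that unfolding box_def by (auto simp: PiE_def extensional_def fun_eq_iff)
      then show ?thesis using \<open>\<omega> \<in> space M\<close> by (simp add: E_def indicator_def)
    qed
    have "s \<omega> = (\<Sum>\<mu>\<in>box. if \<mu> = (\<lambda>c\<in>F. Z c \<omega>) then \<phi> \<mu> else 0)"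
      unfolding s_def by (intro sum.cong) (simp_all add: ind)
    also have "\<dots> = (if (\<lambda>c\<in>F. Z c \<omega>) \<in> box then \<phi> (\<lambda>c\<in>F. Z c \<omega>) else 0)"
      using fin by simp
    also have "(\<lambda>c\<in>F. Z c \<omega>) \<in> box \<longleftrightarrow> (\<forall>c\<in>F. Z c \<omega> \<le> L)"
      unfolding box_def by (auto simp: PiE_iff)
    finally show ?thesis .
  qed
  have ineq: "AE \<omega> in M. \<bar>h \<omega> - s \<omega>\<bar> \<le> 2 * B * indicator bad \<omega>"
    using h_eq AE_space
  proof eventually_elim
    case (elim \<omega>)
    show ?case
    proof (cases "\<omega> \<in> bad")
      case True
      have "\<bar>s \<omega>\<bar> \<le> B" using s_eq[OF elim(2)] \<phi> B by simp
      then show ?thesis using True h(2)[of \<omega>] by simp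
    next
      case False
      then have "\<forall>c\<in>F. Z c \<omega> \<le> L" "\<forall>c\<in>T - F. Z c \<omega> = 0"
        using elim(2) by (auto simp: bad_def not_less)
      then show ?thesis using s_eq[OF elim(2)] elim(1) False by simp
    qed
  qed
  have int_ind: "integrable M (\<lambda>\<omega>. c * indicator A \<omega> :: real)" if "A \<in> sets M" for A c
    using that by (intro integrable_mult_right integrable_real_indicator) (simp_all add: emeasure_eq_measure)
  have int_s: "integrable M s"
    unfolding s_def by (intro Bochner_Integration.integrable_sum int_ind E_sets)
  have int_h: "integrable M h"
    by (rule integrable_const_bound[of _ B]) (use h in auto)
  have exp_s: "expectation s = (\<Sum>\<mu>\<in>box. \<phi> \<mu> * prob (E \<mu>))"
    unfolding s_def using E_sets by (subst Bochner_Integration.integral_sum[OF int_ind[OF E_sets]]) simp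
  have "\<bar>expectation h - expectation s\<bar> = \<bar>expectation (\<lambda>\<omega>. h \<omega> - s \<omega>)\<bar>"
    using int_h int_s by simp
  also have "\<dots> \<le> expectation (\<lambda>\<omega>. \<bar>h \<omega> - s \<omega>\<bar>)" by (rule integral_abs_bound)
  also have "\<dots> \<le> expectation (\<lambda>\<omega>. 2 * B * indicator bad \<omega>)"
    by (rule integral_mono_AE) (use ineq int_h int_s int_ind[OF bad_sets] in auto)
  also have "\<dots> = 2 * B * prob bad" using bad_sets by simp
  also have "\<dots> \<le> 2 * B * \<epsilon>" using tail B unfolding bad_def by (intro mult_left_mono) auto
  finally show ?thesis unfolding exp_s E_def box_def .
qed

lemma prob_geometric_ge:
  assumes "0 \<le> q" "q < 1"
  shows "measure_pmf.prob (geometric_pmf (1 - q)) {j..} = q ^ j"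
proof -
  have pmf: "pmf (geometric_pmf (1 - q)) i = q ^ i * (1 - q)" for i using assms by simp
  have "measure_pmf.prob (geometric_pmf (1 - q)) {..<j} = (\<Sum>i<j. q ^ i * (1 - q))"
    by (subst measure_measure_pmf_finite) (simp_all add: pmf)
  also have "\<dots> = 1 - q ^ j"
    using one_diff_power_eq[of q j] by (simp add: sum_distrib_left mult.commute)
  finally show ?thesis
    using measure_pmf.prob_compl[of "{..<j}" "geometric_pmf (1 - q)"] by (simp add: Compl_eq_Diff_UNIV[symmetric])
qed

text \<open>On all of \<open>nat \<Rightarrow> real\<close> the Borel sets are those of the product
  sigma-algebra, so continuity gives measurability there. \<open>f\<close> is extended to that space
  by precomposing with \<open>restrict\<close>, and the result is pulled back by filling up vectors
  with 0.\<close>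

lemma continuous_map_product_borel_measurable:
  fixes f :: "(nat \<Rightarrow> real) \<Rightarrow> real"
  assumes "continuous_map (product_topology (\<lambda>i. euclideanreal) J) euclideanreal f"
  shows "f \<in> borel_measurable (\<Pi>\<^sub>M i\<in>J. borel)"
proof -
  have "continuous_map (product_topology (\<lambda>i. euclideanreal) UNIV) (product_topology (\<lambda>i. euclideanreal) J) (\<lambda>x. restrict x J)"
    by (auto simp: continuous_map_componentwise intro: continuous_map_product_projection)
  then have "continuous_map (product_topology (\<lambda>i. euclideanreal) UNIV) euclideanreal (f \<circ> (\<lambda>x. restrict x J))"
    using assms by (rule continuous_map_compose)
  then have "continuous_on UNIV (\<lambda>x. f (restrict x J))"
    by (simp add: euclidean_product_topology comp_def)
  then have "(\<lambda>x. f (restrict x J)) \<in> borel_measurable borel"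
    by (rule borel_measurable_continuous_onI)
  then have f: "(\<lambda>x. f (restrict x J)) \<in> borel_measurable (\<Pi>\<^sub>M i\<in>UNIV. borel)"
    using measurable_cong_sets[OF sets_PiM_equal_borel refl] by blast
  have "(\<lambda>x i. if i \<in> J then x i else 0 :: real) \<in> measurable (\<Pi>\<^sub>M i\<in>J. borel) (\<Pi>\<^sub>M i\<in>UNIV. borel)"
  proof (rule measurable_PiM_single')
    fix i :: nat
    show "(\<lambda>x. if i \<in> J then x i else 0 :: real) \<in> borel_measurable (\<Pi>\<^sub>M i\<in>J. borel)"
      by (cases "i \<in> J") auto
  qed auto
  from measurable_compose[OF this f]
  have "(\<lambda>x. f (\<lambda>i\<in>J. if i \<in> J then x i else 0)) \<in> borel_measurable (\<Pi>\<^sub>M i\<in>J. borel)"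
    by (simp add: restrict_def)
  then show ?thesis
    by (rule measurable_cong[THEN iffD1, rotated]) (auto simp: space_PiM PiE_def extensional_def fun_eq_iff intro!: arg_cong[of _ _ f])
qed

section \<open>Convergence of the cycle counts\<close>

lemma measurable_count_space_countable_range:
  fixes f :: "'a \<Rightarrow> 'b"
  assumes R: "countable R" "\<And>\<omega>. \<omega> \<in> space M \<Longrightarrow> f \<omega> \<in> R"
    and f: "\<And>a. a \<in> R \<Longrightarrow> {\<omega>\<in>space M. f \<omega> = a} \<in> sets M"
  shows "f \<in> measurable M (count_space UNIV)"
proof (rule measurableI)
  fix A :: "'b set"
  have "f -` A \<inter> space M = (\<Union>a\<in>A \<inter> R. {\<omega>\<in>space M. f \<omega> = a})" using R(2) by auto
  also have "\<dots> \<in> sets M" using R(1) f by (intro sets.countable_UN') auto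
  finally show "f -` A \<inter> space M \<in> sets M" .
qed simp

lemma is_std_cong: "(\<And>j. j \<in> {1..n} \<Longrightarrow> g j = h j) \<Longrightarrow> is_std n g \<sigma> \<longleftrightarrow> is_std n h \<sigma>"
  unfolding is_std_def by simp

lemma std_perm_restrict: "std_perm n (restrict g {1..n}) = std_perm n g"
proof -
  have "is_std n (restrict g {1..n}) = is_std n g"
    by (rule ext, rule is_std_cong) simp
  then show ?thesis by (simp add: std_perm_def)
qed

text \<open>There are finitely many permutations, and uniqueness turns the event of obtaining
  \<open>\<sigma>\<close> into \<open>is_std\<close>, a finite combination of comparisons between
  the variables.\<close>

lemma measurable_std_perm:
  assumes G: "\<And>j. j \<in> {1..n} \<Longrightarrow> G j \<in> borel_measurable M"
  shows "(\<lambda>\<omega>. std_perm n (\<lambda>j. G j \<omega>)) \<in> measurable M (count_space UNIV)"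
proof (rule measurable_count_space_countable_range)
  show "countable {\<sigma>. \<sigma> permutes {1..n}}" by (intro countable_finite finite_permutations) simp
  show "std_perm n (\<lambda>j. G j \<omega>) \<in> {\<sigma>. \<sigma> permutes {1..n}}" for \<omega>
    using std_perm_permutes by simp
  fix \<sigma>
  have "{\<omega>\<in>space M. std_perm n (\<lambda>j. G j \<omega>) = \<sigma>} = {\<omega>\<in>space M. is_std n (\<lambda>j. G j \<omega>) \<sigma>}"
    using is_std_std_perm is_std_unique by blast
  also have "\<dots> \<in> sets M"
    unfolding is_std_def using G by measurable
  finally show "{\<omega>\<in>space M. std_perm n (\<lambda>j. G j \<omega>) = \<sigma>} \<in> sets M" .
qed

section \<open>Weights of words and their summability over classes\<close>

lemma word_weight_nonneg: "word_weight p w \<ge> 0"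
  unfolding word_weight_def by (induction w) simp_all

lemma word_weight_le_1: "word_weight p w \<le> 1"
  unfolding word_weight_def by (induction w) (auto intro: mult_le_one pmf_le_1 word_weight_nonneg[unfolded word_weight_def])

lemma word_weight_less_1:
  assumes "w \<in> primitive_words I l" "\<forall>i\<in>I. pmf p i < 1"
  shows "word_weight p w < 1"
proof -
  obtain a v where w: "w = a # v" using primitive_wordsD(2,3)[OF assms(1)] by (cases w) auto
  have "word_weight p w \<le> pmf p a * 1"
    unfolding w using word_weight_le_1[of p v] by (simp add: word_weight_def mult_left_le)
  also have "\<dots> < 1" using assms primitive_wordsD(1)[OF assms(1)] w by auto
  finally show ?thesis .
qed

lemma countable_primitive_classes: "countable I \<Longrightarrow> countable (primitive_classes I l)"
proof -
  assume "countable I"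
  then have "countable (lists I)" by (rule countable_lists)
  then have "countable (primitive_words I l)"
    by (rule countable_subset[rotated]) (auto simp: primitive_words_def)
  then show ?thesis unfolding primitive_classes_def quotient_def by auto
qed

text \<open>The weight of a class \<^term>\<open>c\<close> is the probability that it occurs in a random word of length
  \<^term>\<open>k\<close>, and at most \<^term>\<open>k\<close> classes occur in such a word.\<close>

lemma summable_class_weights:
  fixes p :: "real pmf"
  shows "(\<lambda>c. word_weight p (repr c)) summable_on (\<Union>l\<in>{1..k}. primitive_classes I l)"
proof (rule nonneg_bdd_above_summable_on)
  show "bdd_above (sum (\<lambda>c. word_weight p (repr c)) `
      {F. F \<subseteq> (\<Union>l\<in>{1..k}. primitive_classes I l) \<and> finite F})"
  proof (rule bdd_aboveI2)
    fix F assume "F \<in> {F. F \<subseteq> (\<Union>l\<in>{1..k}. primitive_classes I l) \<and> finite F}"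
    then have F: "finite F" "F \<subseteq> (\<Union>l\<in>{1..k}. primitive_classes I l)" by auto
    define A where "A c = {g. 1 \<le> class_mult (past_mset k g) c}" for c
    have weight: "word_weight p (repr c) = measure_pmf.prob (iid_words k p) (A c)" if c: "c \<in> F" for c
    proof -
      obtain l where l: "l \<in> {1..k}" "c \<in> primitive_classes I l" using c F(2) by blast
      then have "card c \<le> k" using primitive_classD(4)[OF l(2) repr_in[OF l(2)]] by simp
      moreover have "{c} \<subseteq> (\<Union>l. primitive_classes I l)" using l(2) by blast
      ultimately show ?thesis
        using prob_class_mult_ge[where F = "{c}" and I = I and \<mu> = "\<lambda>_. 1" and n = k and p = p] by (simp add: A_def)
    qed
    have few: "(\<Sum>c\<in>F. indicator (A c) g :: real) \<le> k" for g
    proof -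
      have "(\<Sum>c\<in>F. indicator (A c) g :: real) = card {c \<in> F. g \<in> A c}"
        using F(1) by (simp add: indicator_def sum.If_cases Int_def)
      also have "card {c \<in> F. g \<in> A c} \<le> card (set_mset (past_mset k g))"
      proof (rule card_inj_on_le[where f = "\<lambda>c. cyc (repr c)"])
        show "inj_on (\<lambda>c. cyc (repr c)) {c \<in> F. g \<in> A c}"
        proof (rule inj_onI)
          fix c c' assume "c \<in> {c \<in> F. g \<in> A c}" "c' \<in> {c \<in> F. g \<in> A c}" "cyc (repr c) = cyc (repr c')"
          moreover then obtain l l' where "c \<in> primitive_classes I l" "c' \<in> primitive_classes I l'"
            using F(2) by blast
          ultimately show "c = c'" using cyc_eq_imp_eq(2) repr_in by metis
        qed
      qed (auto simp: A_def class_mult_def)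
      also have "\<dots> \<le> k" using card_image_le[of "{1..k}" "past k g"] by (simp add: past_mset_def)
      finally show ?thesis by simp
    qed
    have "(\<Sum>c\<in>F. word_weight p (repr c)) = (\<Sum>c\<in>F. measure_pmf.expectation (iid_words k p) (indicator (A c)))"
      by (intro sum.cong) (simp_all add: weight)
    also have "\<dots> = measure_pmf.expectation (iid_words k p) (\<lambda>g. \<Sum>c\<in>F. indicator (A c) g)"
      by (rule Bochner_Integration.integral_sum[symmetric]) (simp add: measure_pmf.emeasure_eq_measure)
    also have "\<dots> \<le> measure_pmf.expectation (iid_words k p) (\<lambda>g. real k)"
      by (intro integral_mono Bochner_Integration.integrable_sum few)
        (simp_all add: measure_pmf.emeasure_eq_measure)
    finally show "(\<Sum>c\<in>F. word_weight p (repr c)) \<le> real k" by simp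
  qed
qed (rule word_weight_nonneg)

text \<open>Almost surely all letters lie in the countable support of \<open>p\<close>, so the law
  of the word is determined by its point probabilities, which are products by independence.\<close>

lemma (in prob_space) expectation_iid_words:
  fixes G :: "nat \<Rightarrow> 'a \<Rightarrow> real" and h :: "(nat \<Rightarrow> real) \<Rightarrow> real"
  assumes n: "n \<ge> 1" and indep: "indep_vars (\<lambda>_. borel) G {1..n}"
    and p: "\<And>j i. j \<in> {1..n} \<Longrightarrow> i \<in> set_pmf p \<Longrightarrow> prob {\<omega>\<in>space M. G j \<omega> = i} = pmf p i"
    and h: "(\<lambda>\<omega>. h (\<lambda>j\<in>{1..n}. G j \<omega>)) \<in> borel_measurable M"
  shows "expectation (\<lambda>\<omega>. h (\<lambda>j\<in>{1..n}. G j \<omega>)) = measure_pmf.expectation (iid_words n p) h"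
proof -
  define W where "W = {1..n} \<rightarrow>\<^sub>E set_pmf p"
  define H where "H \<omega> = (\<lambda>j\<in>{1..n}. G j \<omega>)" for \<omega>
  obtain w0 where w0: "w0 \<in> W" unfolding W_def by (meson PiE_eq_empty_iff all_not_in_conv set_pmf_not_empty)
  \<comment> \<open>Sending the exceptional null set to an arbitrary \<open>w0\<close> gives a
    countable range, hence a measurable map into \<open>count_space UNIV\<close>, on which every
    \<open>h\<close> is measurable.\<close>
  define H' where "H' \<omega> = (if H \<omega> \<in> W then H \<omega> else w0)" for \<omega>
  have W: "countable W" "W = set_pmf (iid_words n p)"
    unfolding W_def using set_iid_words[of n p] by (simp_all add: countable_PiE)
  have G: "G j \<in> borel_measurable M" if "j \<in> {1..n}" for j
    using indep that by (auto simp: indep_vars_def)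
  \<comment> \<open>The point probabilities over the support of \<open>p\<close> already add up to
    1.\<close>
  have G_in: "AE \<omega> in M. G j \<omega> \<in> set_pmf p" if j: "j \<in> {1..n}" for j
  proof -
    have S: "set_pmf p \<in> sets borel" by (rule sets.countable) auto
    have "emeasure (distr M borel (G j)) (set_pmf p) =
        (\<integral>\<^sup>+i. emeasure (distr M borel (G j)) {i} \<partial>count_space (set_pmf p))"
      by (rule emeasure_countable_singleton) auto
    also have "\<dots> = (\<integral>\<^sup>+i. pmf p i \<partial>count_space (set_pmf p))"
      using p[OF j] G[OF j]
      by (intro nn_integral_cong) (simp add: emeasure_distr emeasure_eq_measure vimage_def Int_def conj_commute)
    also have "\<dots> = emeasure (measure_pmf p) (set_pmf p)" by (rule nn_integral_pmf)
    also have "\<dots> = 1" by (simp add: measure_pmf.emeasure_eq_measure measure_pmf.prob_eq_1 AE_measure_pmf)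
    finally have "prob (G j -` set_pmf p \<inter> space M) = 1"
      using S G[OF j] by (simp add: emeasure_distr emeasure_eq_measure)
    then have "AE \<omega> in M. \<omega> \<in> G j -` set_pmf p \<inter> space M"
      using prob_eq_1 measurable_sets[OF G[OF j] S] by blast
    then show ?thesis by eventually_elim simp
  qed
  have "AE \<omega> in M. \<forall>j\<in>{1..n}. G j \<omega> \<in> set_pmf p"
    using G_in by (intro AE_finite_allI) auto
  then have H_in: "AE \<omega> in M. H \<omega> \<in> W"
    by eventually_elim (auto simp: H_def W_def)
  have H_sets: "{\<omega>\<in>space M. H \<omega> = w} \<in> sets M" if "w \<in> W" for w
  proof -
    have "{\<omega>\<in>space M. H \<omega> = w} = {\<omega>\<in>space M. \<forall>j\<in>{1..n}. G j \<omega> = w j}"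
      using that by (auto simp: H_def W_def PiE_def extensional_def fun_eq_iff)
    also have "\<dots> \<in> sets M" using G by measurable
    finally show ?thesis .
  qed
  have H'_measurable: "H' \<in> measurable M (count_space UNIV)"
  proof (rule measurable_count_space_countable_range[OF W(1)])
    show "H' \<omega> \<in> W" for \<omega> using w0 by (simp add: H'_def)
    fix w assume w: "w \<in> W"
    have HW: "{\<omega>\<in>space M. H \<omega> \<notin> W} \<in> sets M"
    proof -
      have "{\<omega>\<in>space M. H \<omega> \<notin> W} = space M - (\<Union>w\<in>W. {\<omega>\<in>space M. H \<omega> = w})" by auto
      also have "\<dots> \<in> sets M" using H_sets W(1) by (intro sets.Diff sets.countable_UN') auto
      finally show ?thesis .
    qed
    have "{\<omega>\<in>space M. H' \<omega> = w} =
        {\<omega>\<in>space M. H \<omega> = w} \<union> (if w = w0 then {\<omega>\<in>space M. H \<omega> \<notin> W} else {})"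
      using w by (auto simp: H'_def)
    also have "\<dots> \<in> sets M" using H_sets[OF w] HW by auto
    finally show "{\<omega>\<in>space M. H' \<omega> = w} \<in> sets M" .
  qed
  have H'_eq: "AE \<omega> in M. H' \<omega> = H \<omega>" using H_in by eventually_elim (simp add: H'_def)
  have "distr M (count_space UNIV) H' = measure_pmf (iid_words n p)"
  proof (rule measure_eqI_countable_AE)
    show "AE w in distr M (count_space UNIV) H'. w \<in> W"
      using w0 by (subst AE_distr_iff[OF H'_measurable]) (auto simp: H'_def)
    show "AE w in measure_pmf (iid_words n p). w \<in> W"
      unfolding W(2) by (rule AE_pmfI)
    fix w assume w: "w \<in> W"
    have "prob {\<omega>\<in>space M. H' \<omega> = w} = prob {\<omega>\<in>space M. H \<omega> = w}"
      using H'_eq H_sets[OF w] measurable_sets[OF H'_measurable, of "{w}"]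
      by (intro finite_measure_eq_AE) (auto simp: vimage_def Int_def conj_commute)
    also have "{\<omega>\<in>space M. H \<omega> = w} = (\<Inter>j\<in>{1..n}. G j -` {w j} \<inter> space M)"
      using w n by (auto simp: H_def W_def PiE_def extensional_def fun_eq_iff)
    also have "prob \<dots> = (\<Prod>j\<in>{1..n}. prob (G j -` {w j} \<inter> space M))"
      using n by (intro indep_varsD_finite[OF indep]) auto
    also have "\<dots> = (\<Prod>j\<in>{1..n}. pmf p (w j))"
    proof (rule prod.cong[OF refl])
      fix j assume j: "j \<in> {1..n}"
      then have "w j \<in> set_pmf p" using w by (auto simp: W_def)
      moreover have "G j -` {w j} \<inter> space M = {\<omega>\<in>space M. G j \<omega> = w j}" by auto
      ultimately show "prob (G j -` {w j} \<inter> space M) = pmf p (w j)" using p[OF j] by simp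
    qed
    also have "\<dots> = pmf (iid_words n p) w"
      using w by (intro pmf_iid_words[symmetric]) (auto simp: W_def)
    finally show "emeasure (distr M (count_space UNIV) H') {w} = emeasure (measure_pmf (iid_words n p)) {w}"
      using H'_measurable
      by (simp add: emeasure_distr emeasure_eq_measure emeasure_pmf_single vimage_def Int_def conj_commute)
  qed (use W in auto)
  then have "measure_pmf.expectation (iid_words n p) h = expectation (\<lambda>\<omega>. h (H' \<omega>))"
    using integral_distr[OF H'_measurable, of h] by simp
  also have "\<dots> = expectation (\<lambda>\<omega>. h (H \<omega>))"
    using H'_eq measurable_compose[OF H'_measurable, of h borel] h
    by (intro integral_cong_AE) (auto simp: H_def)
  finally show ?thesis by (simp add: H_def)
qed

lemma (in prob_space) prob_outside_box_le:
  fixes Z :: "'c \<Rightarrow> 'a \<Rightarrow> nat"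
  assumes F: "finite F" "F \<subseteq> T" and T: "countable T"
    and Z: "\<And>c. c \<in> T \<Longrightarrow> Z c \<in> measurable M (count_space UNIV)"
    and q: "q summable_on T"
    and ge: "\<And>c j. c \<in> T \<Longrightarrow> prob {\<omega>\<in>space M. j \<le> Z c \<omega>} \<le> q c ^ j"
  shows "prob {\<omega>\<in>space M. (\<exists>c\<in>T - F. Z c \<omega> \<noteq> 0) \<or> (\<exists>c\<in>F. L < Z c \<omega>)}
    \<le> (\<Sum>c\<in>F. q c ^ Suc L) + (\<Sum>\<^sub>\<infinity>c\<in>T - F. q c)"
proof -
  \<comment> \<open>One threshold per class turns both kinds of failure into a single union:
    exceeding \<open>L\<close> inside \<open>F\<close>, being nonzero outside.\<close>
  define \<theta> where "\<theta> c = (if c \<in> F then Suc L else 1)" for c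
  have q_rest: "q summable_on (T - F)" by (rule summable_on_subset_banach[OF q]) auto
  then have rest: "(\<lambda>c. q c ^ \<theta> c) summable_on (T - F)"
    by (rule summable_on_cong[THEN iffD1, rotated]) (simp add: \<theta>_def)
  have box: "(\<lambda>c. q c ^ \<theta> c) summable_on F" using F(1) by simp
  have T_eq: "F \<union> (T - F) = T" using F(2) by blast
  have sum: "(\<lambda>c. q c ^ \<theta> c) summable_on T"
    using summable_on_Un_disjoint[OF box rest] T_eq by auto
  have "{\<omega>\<in>space M. (\<exists>c\<in>T - F. Z c \<omega> \<noteq> 0) \<or> (\<exists>c\<in>F. L < Z c \<omega>)} = (\<Union>c\<in>T. {\<omega>\<in>space M. \<theta> c \<le> Z c \<omega>})"
    using F(2) by (auto simp: \<theta>_def Suc_le_eq split: if_splits)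
  also have "prob \<dots> \<le> (\<Sum>\<^sub>\<infinity>c\<in>T. q c ^ \<theta> c)"
  proof (rule union_bound_and_Borel_Cantelli(1)[OF T _ sum ge])
    fix c assume "c \<in> T"
    then show "{\<omega>\<in>space M. \<theta> c \<le> Z c \<omega>} \<in> sets M" using Z by measurable
  qed
  also have "\<dots> = (\<Sum>\<^sub>\<infinity>c\<in>F. q c ^ \<theta> c) + (\<Sum>\<^sub>\<infinity>c\<in>T - F. q c ^ \<theta> c)"
    using infsum_Un_disjoint[OF box rest] T_eq by auto
  also have "(\<Sum>\<^sub>\<infinity>c\<in>F. q c ^ \<theta> c) = (\<Sum>c\<in>F. q c ^ Suc L)" using F(1) by (simp add: \<theta>_def)
  also have "(\<Sum>\<^sub>\<infinity>c\<in>T - F. q c ^ \<theta> c) = (\<Sum>\<^sub>\<infinity>c\<in>T - F. q c)"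
    by (rule infsum_cong) (simp add: \<theta>_def)
  finally show ?thesis .
qed

lemma primitive_classes_disjoint: "l \<noteq> l' \<Longrightarrow> primitive_classes I l \<inter> primitive_classes I l' = {}"
  by (metis disjoint_iff primitive_classD(4) repr_in)

theorem corollary1p3:
  fixes I :: "real set" and p :: "real pmf"
    and M :: "nat \<Rightarrow> 'a measure" and G :: "nat \<Rightarrow> nat \<Rightarrow> 'a \<Rightarrow> real"
    and N :: "'b measure" and X :: "real list set \<Rightarrow> 'b \<Rightarrow> nat" and k :: nat
  assumes "countable I"
    and "set_pmf p \<subseteq> I"
    and "\<forall>i\<in>I. pmf p i < 1"
    and "\<forall>n\<ge>1. prob_space (M n)"
    and "\<forall>n\<ge>1. prob_space.indep_vars (M n) (\<lambda>_. borel) (G n) {1..n}"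
    and "\<forall>n\<ge>1. \<forall>j\<in>{1..n}. \<forall>i\<in>I. \<P>(\<omega> in M n. G n j \<omega> = i) = pmf p i"
    and "k \<ge> 1"
    and "prob_space N"
    and "prob_space.indep_vars N (\<lambda>_. count_space UNIV) X (\<Union>l\<in>{1..k}. primitive_classes I l)"
    and "\<forall>l\<in>{1..k}. \<forall>w\<in>primitive_words I l.
           distr N (count_space UNIV) (X (conjugacy `` {w})) =
             measure_pmf (geometric_pmf (1 - word_weight p w))"
  shows "(AE \<omega> in N. \<forall>l\<in>{1..k}. (\<lambda>c. real (X c \<omega>)) summable_on primitive_classes I l) \<and>
    prob_space.indep_vars N (\<lambda>_. borel) (class_sum I X) {1..k} \<and>
    conv_in_distr {1..k}
      M (\<lambda>n \<omega>. \<lambda>j\<in>{1..k}. real (num_cycles n (std_perm n (\<lambda>j. G n j \<omega>)) j))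
      N (\<lambda>\<omega>. \<lambda>l\<in>{1..k}. class_sum I X l \<omega>)"
proof -
  interpret N: prob_space N by fact
  define T where "T = (\<Union>l\<in>{1..k}. primitive_classes I l)"
  define q where "q c = word_weight p (repr c)" for c
  have T_classes: "T \<subseteq> (\<Union>l. primitive_classes I l)" unfolding T_def by blast
  have T: "countable T"
    unfolding T_def using countable_primitive_classes[OF assms(1)] by simp
  have q_sum: "q summable_on T" unfolding q_def T_def by (rule summable_class_weights)
  have q_nonneg: "q c \<ge> 0" for c unfolding q_def by (rule word_weight_nonneg)
  have indep: "N.indep_vars (\<lambda>_. count_space UNIV) X T" unfolding T_def by fact
  have X: "X c \<in> measurable N (count_space UNIV)" if "c \<in> T" for c
    using indep that by (auto simp: N.indep_vars_def)
  have q_less_1: "q c < 1" and X_ge: "N.prob {\<omega>\<in>space N. j \<le> X c \<omega>} = q c ^ j" if c: "c \<in> T" for c j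
  proof -
    obtain l where l: "l \<in> {1..k}" "c \<in> primitive_classes I l" using c by (auto simp: T_def)
    note r = repr_in[OF l(2)]
    have w: "repr c \<in> primitive_words I l" "c = conjugacy `` {repr c}"
      by (fact primitive_classD(1)[OF l(2) r], fact primitive_classD(2)[OF l(2) r])
    show less: "q c < 1" unfolding q_def using word_weight_less_1[OF w(1)] assms(3) .
    have "distr N (count_space UNIV) (X c) = measure_pmf (geometric_pmf (1 - q c))"
      using assms(10) l(1) w unfolding q_def by metis
    then have "measure (distr N (count_space UNIV) (X c)) {j..} = q c ^ j"
      using prob_geometric_ge[OF q_nonneg less] by simp
    then show "N.prob {\<omega>\<in>space N. j \<le> X c \<omega>} = q c ^ j"
      using X[OF c] by (simp add: measure_distr vimage_def Int_def conj_commute)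
  qed
  have class_sum_measurable: "class_sum I X l \<in> borel_measurable N" if l: "l \<in> {1..k}" for l
    unfolding class_sum_def
  proof (rule borel_measurable_infsum[OF countable_primitive_classes[OF assms(1)]])
    fix c assume "c \<in> primitive_classes I l"
    then have "c \<in> T" using l unfolding T_def by blast
    then show "(\<lambda>\<omega>. real (X c \<omega>)) \<in> borel_measurable N"
      by (intro measurable_compose[OF X]) simp_all
  qed

  \<comment> \<open>The events \<open>X c \<ge> 1\<close> have summable probabilities, so almost
    surely only finitely many \<open>X c\<close> are nonzero.\<close>
  have summable: "AE \<omega> in N. \<forall>l\<in>{1..k}. (\<lambda>c. real (X c \<omega>)) summable_on primitive_classes I l"
  proof -
    have "AE \<omega> in N. finite {c \<in> T. \<omega> \<in> {\<omega>\<in>space N. 1 \<le> X c \<omega>}}"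
    proof (rule N.union_bound_and_Borel_Cantelli(2)[OF T _ q_sum])
      show "{\<omega>\<in>space N. 1 \<le> X c \<omega>} \<in> sets N" if "c \<in> T" for c using X[OF that] by measurable
      show "N.prob {\<omega>\<in>space N. 1 \<le> X c \<omega>} \<le> q c" if "c \<in> T" for c using X_ge[OF that, of 1] by simp
    qed
    with AE_space show ?thesis
    proof eventually_elim
      case (elim \<omega>)
      show ?case
      proof
        fix l assume "l \<in> {1..k}"
        then have "{c \<in> primitive_classes I l. real (X c \<omega>) \<noteq> 0} \<subseteq> {c \<in> T. \<omega> \<in> {\<omega>\<in>space N. 1 \<le> X c \<omega>}}"
          using elim(1) by (auto simp: T_def)
        then show "(\<lambda>c. real (X c \<omega>)) summable_on primitive_classes I l"
          using elim(2) finite_subset by (intro finite_nonzero_values_imp_summable_on) blast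
      qed
    qed
  qed

  \<comment> \<open>Classes of different lengths form disjoint blocks, and each sum is a measurable
    function of its own block.\<close>
  have indep_sums: "N.indep_vars (\<lambda>_. borel) (class_sum I X) {1..k}"
  proof -
    have "N.indep_vars (\<lambda>l. \<Pi>\<^sub>M c\<in>primitive_classes I l. count_space UNIV)
        (\<lambda>l \<omega>. \<lambda>c\<in>primitive_classes I l. X c \<omega>) {1..k}"
      by (rule N.indep_vars_restrict[OF indep])
        (use primitive_classes_disjoint in \<open>auto simp: T_def disjoint_family_on_def\<close>)
    then have "N.indep_vars (\<lambda>_. borel)
        (\<lambda>l \<omega>. \<Sum>\<^sub>\<infinity>c\<in>primitive_classes I l. real ((\<lambda>c\<in>primitive_classes I l. X c \<omega>) c)) {1..k}"
      by (rule N.indep_vars_compose2)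
        (auto intro!: borel_measurable_infsum countable_primitive_classes[OF assms(1)])
    also have "(\<lambda>l \<omega>. \<Sum>\<^sub>\<infinity>c\<in>primitive_classes I l. real ((\<lambda>c\<in>primitive_classes I l. X c \<omega>) c)) = class_sum I X"
      unfolding class_sum_def by (intro ext infsum_cong) simp
    finally show ?thesis .
  qed

  define Y where "Y n g = (\<lambda>j\<in>{1..k}. real (num_cycles n (std_perm n g) j))" for n g
  define Z where "Z \<omega> = (\<lambda>l\<in>{1..k}. class_sum I X l \<omega>)" for \<omega>
  \<comment> \<open>This is the value of the cycle count vector and of the limit vector alike when
    the multiplicities are \<open>\<mu>\<close> on \<open>F\<close> and 0 on
    \<open>T - F\<close>.\<close>
  define \<Phi> where "\<Phi> F \<mu> = (\<lambda>l\<in>{1..k}. real (\<Sum>c\<in>F \<inter> primitive_classes I l. \<mu> c))" for F and \<mu> :: "real list set \<Rightarrow> nat"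
  have Z_measurable: "Z \<in> measurable N (\<Pi>\<^sub>M i\<in>{1..k}. borel)"
    unfolding Z_def by (rule measurable_restrict) (rule class_sum_measurable)
  have Y_measurable: "(\<lambda>\<omega>. Y n (\<lambda>j. G n j \<omega>)) \<in> measurable (M n) (\<Pi>\<^sub>M i\<in>{1..k}. borel)" if n: "n \<ge> 1" for n
  proof -
    interpret prob_space "M n" using assms(4) n by blast
    have "indep_vars (\<lambda>_. borel) (G n) {1..n}" using assms(5) n by blast
    then have "G n j \<in> borel_measurable (M n)" if "j \<in> {1..n}" for j
      using that by (auto simp: indep_vars_def)
    then have "(\<lambda>\<omega>. std_perm n (\<lambda>j. G n j \<omega>)) \<in> measurable (M n) (count_space UNIV)"
      by (rule measurable_std_perm)
    then have "(\<lambda>\<omega>. real (num_cycles n (std_perm n (\<lambda>j. G n j \<omega>)) j)) \<in> borel_measurable (M n)" for j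
      by (rule measurable_compose) simp
    then show ?thesis unfolding Y_def by (intro measurable_restrict)
  qed

  have conv: "(\<lambda>n. \<integral>\<omega>. f (Y n (\<lambda>j. G n j \<omega>)) \<partial>M n) \<longlonglongrightarrow> (\<integral>\<omega>. f (Z \<omega>) \<partial>N)"
    if cont: "continuous_map (product_topology (\<lambda>i. euclideanreal) {1..k}) euclideanreal f"
      and bounded: "bounded (f ` ({1..k} \<rightarrow>\<^sub>E UNIV))" for f
  proof (rule LIMSEQ_I)
    fix e :: real assume e: "e > 0"
    obtain B where B: "B > 0" "\<And>x. x \<in> {1..k} \<rightarrow>\<^sub>E UNIV \<Longrightarrow> \<bar>f x\<bar> \<le> B"
      using bounded unfolding bounded_pos by auto
    have f_measurable: "f \<in> borel_measurable (\<Pi>\<^sub>M i\<in>{1..k}. borel)"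
      by (rule continuous_map_product_borel_measurable[OF cont])
    have f_Y: "\<bar>f (Y n g)\<bar> \<le> B" and f_Z: "\<bar>f (Z \<omega>)\<bar> \<le> B" and f_\<Phi>: "\<bar>f (\<Phi> F \<mu>)\<bar> \<le> B" for n g \<omega> F \<mu>
      by (auto intro!: B(2) simp: Y_def Z_def \<Phi>_def)
    \<comment> \<open>The two approximations below cost \<open>2 * B * \<epsilon>\<close> each; the
      5 keeps their sum strictly below \<open>e\<close>.\<close>
    define \<epsilon> where "\<epsilon> = e / (5 * B)"
    have \<epsilon>: "\<epsilon> > 0" using e B(1) by (simp add: \<epsilon>_def)
    obtain F where F: "finite F" "F \<subseteq> T" and F_tail: "(\<Sum>\<^sub>\<infinity>c\<in>T - F. q c) < \<epsilon> / 2"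
    proof -
      have "\<forall>\<^sub>F F in finite_subsets_at_top T. dist (sum q F) (infsum q T) < \<epsilon> / 2"
        using infsum_tendsto[OF q_sum] \<epsilon> by (intro tendstoD) auto
      then obtain F where F: "finite F" "F \<subseteq> T" "dist (sum q F) (infsum q T) < \<epsilon> / 2"
        unfolding eventually_finite_subsets_at_top by blast
      have "(\<Sum>\<^sub>\<infinity>c\<in>T - F. q c) = infsum q T - sum q F"
        using infsum_Diff[OF q_sum, of F] F(1,2) by simp
      then have "(\<Sum>\<^sub>\<infinity>c\<in>T - F. q c) < \<epsilon> / 2" using F(3) unfolding dist_real_def by linarith
      then show ?thesis by (rule that[OF F(1,2)])
    qed
    \<comment> \<open>As no letter has probability 1, each \<open>q c\<close> is less than 1, and
      the powers tend to 0 on the finite set \<open>F\<close>.\<close>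
    obtain L where L: "(\<Sum>c\<in>F. q c ^ Suc L) < \<epsilon> / 2"
    proof -
      have "(\<lambda>L. \<Sum>c\<in>F. q c ^ Suc L) \<longlonglongrightarrow> (\<Sum>c\<in>F. 0)"
        using q_nonneg q_less_1 F(2) by (intro tendsto_sum LIMSEQ_Suc LIMSEQ_power_zero) auto
      then have "\<forall>\<^sub>F L in sequentially. (\<Sum>c\<in>F. q c ^ Suc L) < \<epsilon> / 2"
        using \<epsilon> by (intro order_tendstoD) auto
      then show ?thesis using that by (auto simp: eventually_sequentially)
    qed
    define S where "S = (\<Sum>\<mu>\<in>F \<rightarrow>\<^sub>E {..L}. f (\<Phi> F \<mu>) * N.prob {\<omega>\<in>space N. \<forall>c\<in>F. X c \<omega> = \<mu> c})"
    have approx_N: "\<bar>(\<integral>\<omega>. f (Z \<omega>) \<partial>N) - S\<bar> \<le> 2 * B * \<epsilon>"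
      unfolding S_def
    proof (rule N.expectation_approx_by_box[OF F T X _ f_Z f_\<Phi>])
      show "(\<lambda>\<omega>. f (Z \<omega>)) \<in> borel_measurable N"
        by (rule measurable_compose[OF Z_measurable f_measurable])
      have "Z \<omega> = \<Phi> F (\<lambda>c\<in>F. X c \<omega>)" if zero: "\<forall>c\<in>T - F. X c \<omega> = 0" for \<omega>
      proof -
        have "class_sum I X l \<omega> = real (\<Sum>c\<in>F \<inter> primitive_classes I l. (\<lambda>c\<in>F. X c \<omega>) c)" if l: "l \<in> {1..k}" for l
        proof -
          have "X c \<omega> = 0" if "c \<in> primitive_classes I l - F" for c
            using zero l that unfolding T_def by blast
          then have "class_sum I X l \<omega> = (\<Sum>\<^sub>\<infinity>c\<in>F \<inter> primitive_classes I l. real (X c \<omega>))"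
            unfolding class_sum_def by (intro infsum_cong_neutral) auto
          also have "\<dots> = (\<Sum>c\<in>F \<inter> primitive_classes I l. real (X c \<omega>))" using F(1) by simp
          finally show ?thesis by simp
        qed
        then show ?thesis unfolding Z_def \<Phi>_def by (intro restrict_ext)
      qed
      then show "AE \<omega> in N. (\<forall>c\<in>T - F. X c \<omega> = 0) \<longrightarrow> f (Z \<omega>) = f (\<Phi> F (\<lambda>c\<in>F. X c \<omega>))" by simp
      have "N.prob {\<omega>\<in>space N. (\<exists>c\<in>T - F. X c \<omega> \<noteq> 0) \<or> (\<exists>c\<in>F. L < X c \<omega>)}
          \<le> (\<Sum>c\<in>F. q c ^ Suc L) + (\<Sum>\<^sub>\<infinity>c\<in>T - F. q c)"
        by (rule N.prob_outside_box_le[OF F T X q_sum]) (simp_all add: X_ge)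
      then show "N.prob {\<omega>\<in>space N. (\<exists>c\<in>T - F. X c \<omega> \<noteq> 0) \<or> (\<exists>c\<in>F. L < X c \<omega>)} \<le> \<epsilon>"
        using F_tail L by linarith
    qed
    \<comment> \<open>On the box a threshold \<open>\<nu> c \<le> Suc (\<mu> c)\<close> is at most
      \<open>Suc L\<close>, so from \<open>n0\<close> on the exact formula applies to all of them at
      once. The outer \<open>Suc\<close> ensures \<open>n \<ge> 1\<close>.\<close>
    define n0 where "n0 = Suc (\<Sum>c\<in>F. Suc L * card c)"
    have approx_M: "\<bar>(\<integral>\<omega>. f (Y n (\<lambda>j. G n j \<omega>)) \<partial>M n) - S\<bar> \<le> 2 * B * \<epsilon>" if n: "n \<ge> n0" for n
    proof -
      have n1: "n \<ge> 1" using n by (simp add: n0_def)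
      interpret Mn: prob_space "M n" using assms(4) n1 by blast
      define m where "m c g = class_mult (past_mset n g) c" for c g
      have m_ge: "measure_pmf.prob (iid_words n p) {g. \<forall>c\<in>F'. \<nu> c \<le> m c g} =
          (if (\<Sum>c\<in>F'. \<nu> c * card c) \<le> n then \<Prod>c\<in>F'. q c ^ \<nu> c else 0)"
        if "finite F'" "F' \<subseteq> T" for F' \<nu>
        unfolding m_def q_def by (rule prob_class_mult_ge[OF that(1) order_trans[OF that(2) T_classes]])
      have "(\<integral>\<omega>. f (Y n (\<lambda>j. G n j \<omega>)) \<partial>M n) = measure_pmf.expectation (iid_words n p) (\<lambda>g. f (Y n g))"
      proof -
        \<comment> \<open>The standardization sees only the letters at \<open>{1..n}\<close>, so the
          word may be taken extensional, as the words of \<open>iid_words\<close> are.\<close>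
        have Y_restrict: "Y n (restrict g {1..n}) = Y n g" for g
          by (simp add: Y_def std_perm_restrict del: One_nat_def)
        have "(\<lambda>\<omega>. f (Y n (\<lambda>j\<in>{1..n}. G n j \<omega>))) \<in> borel_measurable (M n)"
          unfolding Y_restrict by (rule measurable_compose[OF Y_measurable[OF n1] f_measurable])
        then have "Mn.expectation (\<lambda>\<omega>. f (Y n (\<lambda>j\<in>{1..n}. G n j \<omega>))) =
            measure_pmf.expectation (iid_words n p) (\<lambda>g. f (Y n g))"
          using assms(2,5,6) n1 by (intro Mn.expectation_iid_words) auto
        then show ?thesis unfolding Y_restrict .
      qed
      moreover have "S = (\<Sum>\<mu>\<in>F \<rightarrow>\<^sub>E {..L}. f (\<Phi> F \<mu>) *
          measure_pmf.prob (iid_words n p) {g \<in> space (iid_words n p). \<forall>c\<in>F. m c g = \<mu> c})"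
        unfolding S_def
      proof (intro sum.cong refl arg_cong[where f = "(*) _"])
        fix \<mu> assume \<mu>: "\<mu> \<in> F \<rightarrow>\<^sub>E {..L}"
        show "N.prob {\<omega>\<in>space N. \<forall>c\<in>F. X c \<omega> = \<mu> c} =
            measure_pmf.prob (iid_words n p) {g \<in> space (iid_words n p). \<forall>c\<in>F. m c g = \<mu> c}"
        proof (rule prob_eq_of_prob_ge[OF N.finite_measure_axioms measure_pmf.finite_measure F(1)])
          fix \<nu> assume \<nu>: "\<forall>c\<in>F. \<nu> c \<le> Suc (\<mu> c)"
          have "(\<Sum>c\<in>F. \<nu> c * card c) \<le> (\<Sum>c\<in>F. Suc L * card c)"
            using \<nu> \<mu> by (intro sum_mono mult_right_mono) (auto simp: PiE_iff intro: le_trans)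
          then have "measure_pmf.prob (iid_words n p) {g \<in> space (iid_words n p). \<forall>c\<in>F. \<nu> c \<le> m c g} =
              (\<Prod>c\<in>F. q c ^ \<nu> c)"
            using m_ge[OF F, of \<nu>] n by (simp add: n0_def)
          moreover have "N.prob {\<omega>\<in>space N. \<forall>c\<in>F. \<nu> c \<le> X c \<omega>} = (\<Prod>c\<in>F. q c ^ \<nu> c)"
          proof (cases "F = {}")
            case False
            have "{\<omega>\<in>space N. \<forall>c\<in>F. \<nu> c \<le> X c \<omega>} = (\<Inter>c\<in>F. X c -` {\<nu> c..} \<inter> space N)"
              using False by auto
            also have "N.prob \<dots> = (\<Prod>c\<in>F. N.prob (X c -` {\<nu> c..} \<inter> space N))"
              by (rule N.indep_varsD[OF indep False F]) simp
            also have "\<dots> = (\<Prod>c\<in>F. q c ^ \<nu> c)"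
              using X_ge F(2) by (intro prod.cong) (auto simp: vimage_def Int_def conj_commute)
            finally show ?thesis .
          qed (simp add: N.prob_space)
          ultimately show "N.prob {\<omega>\<in>space N. \<forall>c\<in>F. \<nu> c \<le> X c \<omega>} =
              measure_pmf.prob (iid_words n p) {g \<in> space (iid_words n p). \<forall>c\<in>F. \<nu> c \<le> m c g}" by simp
        qed (use X F(2) in auto)
      qed
      moreover have "\<bar>measure_pmf.expectation (iid_words n p) (\<lambda>g. f (Y n g)) -
          (\<Sum>\<mu>\<in>F \<rightarrow>\<^sub>E {..L}. f (\<Phi> F \<mu>) *
            measure_pmf.prob (iid_words n p) {g \<in> space (iid_words n p). \<forall>c\<in>F. m c g = \<mu> c})\<bar> \<le> 2 * B * \<epsilon>"
      proof (rule measure_pmf.expectation_approx_by_box[OF F T _ _ f_Y f_\<Phi>])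
        have "f (Y n g) = f (\<Phi> F (\<lambda>c\<in>F. m c g))"
          if g: "g \<in> {1..n} \<rightarrow>\<^sub>E set_pmf p" and zero: "\<forall>c\<in>T - F. m c g = 0" for g
        proof -
          have "num_cycles n (std_perm n g) l = (\<Sum>c\<in>F \<inter> primitive_classes I l. (\<lambda>c\<in>F. m c g) c)"
            if l: "l \<in> {1..k}" for l
          proof -
            have "num_cycles n (std_perm n g) l = (\<Sum>c\<in>F \<inter> primitive_classes I l. class_mult (past_mset n g) c)"
            proof (rule num_cycles_eq_sum_class_mult)
              show "g ` {1..n} \<subseteq> I" using g assms(2) by auto
              show "class_mult (past_mset n g) c = 0"
                if "c \<in> primitive_classes I l - F \<inter> primitive_classes I l" for c
                using zero l that unfolding m_def T_def by blast
            qed (use F(1) l in auto)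
            then show ?thesis by (simp add: m_def)
          qed
          then have "Y n g = \<Phi> F (\<lambda>c\<in>F. m c g)"
            unfolding Y_def \<Phi>_def by (intro restrict_ext) simp
          then show ?thesis by simp
        qed
        then show "AE g in iid_words n p. (\<forall>c\<in>T - F. m c g = 0) \<longrightarrow> f (Y n g) = f (\<Phi> F (\<lambda>c\<in>F. m c g))"
          unfolding AE_measure_pmf_iff set_iid_words by blast
        \<comment> \<open>If \<open>n\<close> is too small for \<open>j\<close> copies the
          probability is 0, so this bound holds without a threshold on \<open>n\<close>.\<close>
        have m_le: "measure_pmf.prob (iid_words n p) {g \<in> space (iid_words n p). j \<le> m c g} \<le> q c ^ j"
          if c: "c \<in> T" for c j
          using m_ge[of "{c}" "\<lambda>_. j"] c q_nonneg[of c] by simp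
        have "measure_pmf.prob (iid_words n p)
            {g \<in> space (iid_words n p). (\<exists>c\<in>T - F. m c g \<noteq> 0) \<or> (\<exists>c\<in>F. L < m c g)}
            \<le> (\<Sum>c\<in>F. q c ^ Suc L) + (\<Sum>\<^sub>\<infinity>c\<in>T - F. q c)"
          by (rule measure_pmf.prob_outside_box_le[OF F T _ q_sum m_le]) simp_all
        then show "measure_pmf.prob (iid_words n p)
            {g \<in> space (iid_words n p). (\<exists>c\<in>T - F. m c g \<noteq> 0) \<or> (\<exists>c\<in>F. L < m c g)} \<le> \<epsilon>"
          using F_tail L by linarith
      qed simp_all
      ultimately show ?thesis by simp
    qed
    have "norm ((\<integral>\<omega>. f (Y n (\<lambda>j. G n j \<omega>)) \<partial>M n) - (\<integral>\<omega>. f (Z \<omega>) \<partial>N)) < e" if "n \<ge> n0" for n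
    proof -
      have "4 * B * \<epsilon> < e" using e B(1) by (simp add: \<epsilon>_def)
      then show ?thesis
        using approx_N approx_M[OF that] by (simp add: abs_le_iff abs_less_iff)
    qed
    then show "\<exists>n0. \<forall>n\<ge>n0. norm ((\<integral>\<omega>. f (Y n (\<lambda>j. G n j \<omega>)) \<partial>M n) - (\<integral>\<omega>. f (Z \<omega>) \<partial>N)) < e" by blast
  qed
  have "conv_in_distr {1..k} M (\<lambda>n \<omega>. Y n (\<lambda>j. G n j \<omega>)) N Z"
    unfolding conv_in_distr_def
  proof (intro conjI allI impI)
    show "\<forall>\<^sub>F n in sequentially. (\<lambda>\<omega>. Y n (\<lambda>j. G n j \<omega>)) \<in> measurable (M n) (\<Pi>\<^sub>M i\<in>{1..k}. borel)"
      by (rule eventually_mono[OF eventually_ge_at_top Y_measurable])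
  qed (fact Z_measurable, fact conv)
  with summable indep_sums show ?thesis unfolding Y_def Z_def by (intro conjI)
qed

end
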